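(* Let $F, G \in \mathcal{F}(\mathbb{R})$ and let $W = (w_N)_{N \in \mathbb{N}}$ be a weight function system that satisfies $(\alpha)$, $(N)$, and $(\epsilon)_{0}$. Then, for all $N \in \mathbb{N}$ there is $M > N$ such that for all $K > M$ and for all $1<a<b<\infty$: $$\forall \varepsilon >0 \ \ \forall f \in \mathcal{U}_{w_M}(T^{a F, a G}) \ \ \exists g \in \mathcal{U}_{w_K}(T^{b F, b G}): \quad \sup_{\xi \in \overline{T^{F, G}}} e^{w_N(\lvert \operatorname{Re}\xi\rvert)} \lvert f(\xi) - g(\xi)\rvert \leq \varepsilon .$$
   Context: $\mathcal{F}(\mathbb{R})$ is the family of all uniformly continuous functions $F\colon\mathbb{R}\to(0,\infty)$ with $0<\inf_{t\in\mathbb{R}}F(t)\le\sup_{t\in\mathbb{R}}F(t)<\infty$. For $F,G\in\mathcal{F}(\mathbb{R})$, the generalized strip is $T^{F,G}=\{z\in\mathbb{C} : -G(\operatorname{Re} z)<\operatorname{Im} z<F(\operatorname{Re} z)\}$. A weight function is a non-decreasing unbounded function $w\colon[0,\infty)\to[0,\infty)$. A weight function system is a pointwise non-decreasing sequence $W=(w_N)_{N\in\mathbb{N}}$ of weight functions. Conditions on $W$: $(\alpha)$: $\forall N\in\mathbb{N}\ \exists M>N,\ A>1\ \forall t\ge0:\ w_N(2t)\le w_M(t)+\log A$. $(\epsilon)_0$: $\forall N\in\mathbb{N}\ \forall\mu>0:\ \int_0^\infty w_N(t)e^{-\mu t}\,\mathrm{d}t<\infty$. $(N)$: $\forall N\in\mathbb{N}\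 \exists M>N:\ \int_0^\infty e^{w_N(t)-w_M(t)}\,\mathrm{d}t<\infty$. For a single weight function $w$ and $F,G\in\mathcal{F}(\mathbb{R})$, $\mathcal{U}_w(T^{F,G})$ is the space of all holomorphic functions $f$ on $T^{F,G}$ such that for all $\alpha\in\mathbb{N}^2$ (multi-indices, including $0$) and all $c\in(0,1)$: $$\sup_{\xi\in\overline{T^{cF,cG}}}e^{w(|\operatorname{Re}\xi|)}|f^{(\alpha)}(\xi)|<\infty,\qquad f^{(\alpha)}=\partial_x^{\alpha_1}\partial_y^{\alpha_2}f.$$ *)

theory Defs
  imports "HOL-Complex_Analysis.Complex_Analysis"
begin

(* Since F is positive, its range is bounded below, so the real-valued INF is the
   genuine infimum. *)
definition strip_functions :: "(real \<Rightarrow> real) set" where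
  "strip_functions = {F. uniformly_continuous_on UNIV F \<and> (\<forall>t. 0 < F t)
     \<and> 0 < (INF t. F t) \<and> bdd_above (range F)}"

definition gen_strip :: "(real \<Rightarrow> real) \<Rightarrow> (real \<Rightarrow> real) \<Rightarrow> complex set" where
  "gen_strip F G = {z. - G (Re z) < Im z \<and> Im z < F (Re z)}"

(* A weight function lives on the half line [0, infinity); its values at negative
   arguments are arbitrary and never used. *)
definition weight_function :: "(real \<Rightarrow> real) \<Rightarrow> bool" where
  "weight_function w \<longleftrightarrow>
     (\<forall>t\<ge>0. 0 \<le> w t) \<and> mono_on {0..} w \<and> \<not> bdd_above (w ` {0..})"

definition weight_function_system :: "(nat \<Rightarrow> real \<Rightarrow> real) \<Rightarrow> bool" where
  "weight_function_system W \<longleftrightarrow>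
     (\<forall>N. weight_function (W N)) \<and> (\<forall>N M. N \<le> M \<longrightarrow> (\<forall>t\<ge>0. W N t \<le> W M t))"

definition cond_alpha :: "(nat \<Rightarrow> real \<Rightarrow> real) \<Rightarrow> bool" where
  "cond_alpha W \<longleftrightarrow>
     (\<forall>N. \<exists>M>N. \<exists>A>1. \<forall>t\<ge>0. W N (2 * t) \<le> W M t + ln A)"

(* The integrands below are nonnegative and, for monotone weights, measurable on
   [0, infinity), so the nonnegative Lebesgue integral is the usual one. *)
definition cond_epsilon0 :: "(nat \<Rightarrow> real \<Rightarrow> real) \<Rightarrow> bool" where
  "cond_epsilon0 W \<longleftrightarrow>
     (\<forall>N. \<forall>\<mu>>0. (\<integral>\<^sup>+t\<in>{0..}. ennreal (W N t * exp (- \<mu> * t)) \<partial>lborel) < \<infinity>)"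

definition cond_N :: "(nat \<Rightarrow> real \<Rightarrow> real) \<Rightarrow> bool" where
  "cond_N W \<longleftrightarrow>
     (\<forall>N. \<exists>M>N. (\<integral>\<^sup>+t\<in>{0..}. ennreal (exp (W N t - W M t)) \<partial>lborel) < \<infinity>)"

definition partial_x :: "(complex \<Rightarrow> complex) \<Rightarrow> complex \<Rightarrow> complex" where
  "partial_x f z = vector_derivative (\<lambda>t. f (z + of_real t)) (at 0)"

definition partial_y :: "(complex \<Rightarrow> complex) \<Rightarrow> complex \<Rightarrow> complex" where
  "partial_y f z = vector_derivative (\<lambda>t. f (z + \<i> * of_real t)) (at 0)"

definition partial_deriv :: "nat \<times> nat \<Rightarrow> (complex \<Rightarrow> complex) \<Rightarrow> complex \<Rightarrow> complex" where
  "partial_deriv \<alpha> f = (partial_x ^^ fst \<alpha>) ((partial_y ^^ snd \<alpha>) f)"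

(* A holomorphic function on the strip is represented by a total function whose values
   off the strip are irrelevant: for 0 < c < 1 the closed strip below lies in the open
   strip gen_strip F G, so all partial derivatives there depend only on f on the latter.
   Suprema are taken in the extended reals. *)
definition U_space ::
    "(real \<Rightarrow> real) \<Rightarrow> (real \<Rightarrow> real) \<Rightarrow> (real \<Rightarrow> real) \<Rightarrow> (complex \<Rightarrow> complex) set" where
  "U_space w F G = {f. f holomorphic_on gen_strip F G \<and>
     (\<forall>\<alpha>. \<forall>c\<in>{0<..<1}.
        (SUP \<xi>\<in>closure (gen_strip (\<lambda>t. c * F t) (\<lambda>t. c * G t)).
           ereal (exp (w \<bar>Re \<xi>\<bar>) * norm (partial_deriv \<alpha> f \<xi>))) < \<infinity>)}"

end

theory Submission imports Defs
begin

text \<open>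
  By \<open>(\<epsilon>)\<^sub>0\<close> every weight is \<open>O(exp (\<mu> * t))\<close> for all \<open>\<mu> > 0\<close>, so for small \<open>\<mu>\<close> the factor
  \<open>P\<^sub>\<delta>(z) = exp (- \<delta> * cosh (\<mu> * z))\<close> beats all weights on a wide horizontal strip, while
  \<open>P\<^sub>\<delta> \<rightarrow> 1\<close> boundedly as \<open>\<delta> \<rightarrow> 0\<close>. Conditions \<open>(\<alpha>)\<close> and \<open>(N)\<close> give \<open>M\<close> with
  \<open>w\<^sub>M - w\<^sub>N \<rightarrow> \<infinity>\<close>, hence \<open>f * P\<^sub>\<delta>\<^sup>2\<close> is close to \<open>f\<close> in the \<open>w\<^sub>N\<close>-norm. It remains to approximate
  the decaying function \<open>f * P\<^sub>\<delta>\<close> uniformly on the strip by a bounded holomorphic function \<open>h\<close> on a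
  larger strip; then \<open>g = P\<^sub>\<delta> * h\<close> has all the required decay. Cauchy integrals over
  horizontal lines split \<open>f * P\<^sub>\<delta>\<close> into a summand that is bounded and holomorphic below the upper
  boundary curve and one that is so above the lower boundary curve. For each summand the domain
  is enlarged step by step in the vertical direction: the Taylor polynomial about the
  point at distance \<open>\<tau>\<close> inside the domain, as a function of its argument, is defined on the
  domain shifted by \<open>\<tau>\<close>.
\<close>

subsection \<open>Weights\<close>

lemma weight_function_nonneg: "weight_function w \<Longrightarrow> 0 \<le> t \<Longrightarrow> 0 \<le> w t"
  by (simp add: weight_function_def)

lemma weight_function_mono: "weight_function w \<Longrightarrow> 0 \<le> s \<Longrightarrow> s \<le> t \<Longrightarrow> w s \<le> w t"
  by (auto simp: weight_function_def mono_on_def)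

lemma nn_integral_ge_interval:
  fixes a b c :: real
  assumes "0 \<le> a" "a \<le> b" and "\<And>s. a \<le> s \<Longrightarrow> s \<le> b \<Longrightarrow> c \<le> h s"
  shows "ennreal (c * (b - a)) \<le> (\<integral>\<^sup>+t\<in>{0..}. ennreal (h t) \<partial>lborel)"
proof -
  have "ennreal (c * (b - a)) = ennreal c * emeasure lborel {a..b}"
    using assms by (simp add: ennreal_mult'')
  also have "\<dots> = (\<integral>\<^sup>+t. ennreal c * indicator {a..b} t \<partial>lborel)"
    by (simp add: nn_integral_cmult_indicator)
  also have "\<dots> \<le> (\<integral>\<^sup>+t\<in>{0..}. ennreal (h t) \<partial>lborel)"
    using assms by (intro nn_integral_mono) (auto simp: indicator_def intro!: ennreal_leI)
  finally show ?thesis .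
qed

text \<open>Since the weights are monotone, integrating over \<open>{u/2..u}\<close> turns \<open>(N)\<close> into a pointwise
  bound; \<open>(\<alpha>)\<close> makes up for the halved argument.\<close>

lemma weight_gap:
  assumes W: "weight_function_system W" and \<alpha>: "cond_alpha W" and N: "cond_N W"
  shows "\<exists>M>N. \<exists>C\<ge>0. \<forall>u>0. exp (W N u - W M u) \<le> C / u"
proof -
  obtain L A where L: "L > N" and A: "A > 1" and WL: "\<And>t. t \<ge> 0 \<Longrightarrow> W N (2 * t) \<le> W L t + ln A"
    using \<alpha> unfolding cond_alpha_def by meson
  obtain M where M: "M > L" and fin: "(\<integral>\<^sup>+t\<in>{0..}. ennreal (exp (W L t - W M t)) \<partial>lborel) < \<infinity>"
    using N unfolding cond_N_def by meson
  obtain I where I: "I \<ge> 0" "(\<integral>\<^sup>+t\<in>{0..}. ennreal (exp (W L t - W M t)) \<partial>lborel) = ennreal I"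
    using fin by (cases "\<integral>\<^sup>+t\<in>{0..}. ennreal (exp (W L t - W M t)) \<partial>lborel" rule: ennreal_cases) auto
  have w: "weight_function (W n)" for n
    using W by (simp add: weight_function_system_def)
  \<comment> \<open>The factor 2 comes from the length u/2 of the interval of integration, the
    factor \<open>A\<close> from the term \<open>ln A\<close> in (\<alpha>).\<close>
  have "exp (W N u - W M u) \<le> (2 * A * I) / u" if u: "u > 0" for u
  proof -
    let ?c = "exp (W N u - ln A - W M u)"
    have "ennreal (?c * (u - u/2)) \<le> (\<integral>\<^sup>+t\<in>{0..}. ennreal (exp (W L t - W M t)) \<partial>lborel)"
    proof (rule nn_integral_ge_interval)
      fix s assume s: "u/2 \<le> s" "s \<le> u"
      have "W N u - ln A \<le> W L (u/2)" using WL[of "u/2"] u by simp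
      also have "\<dots> \<le> W L s" using weight_function_mono[OF w] s u by simp
      finally have "W N u - ln A \<le> W L s" .
      moreover have "W M s \<le> W M u" using weight_function_mono[OF w] s u by simp
      ultimately show "?c \<le> exp (W L s - W M s)" by simp
    qed (use u in auto)
    then have "?c * (u/2) \<le> I" using I by (simp add: ennreal_le_iff)
    moreover have "?c = exp (W N u - W M u) / A"
      using A by (simp add: exp_diff)
    ultimately have "exp (W N u - W M u) / A * (u / 2) \<le> I" by metis
    then show ?thesis using A u by (simp add: field_simps)
  qed
  moreover have "M > N" using L M by simp
  moreover have "2 * A * I \<ge> 0" using A I by simp
  ultimately show ?thesis by blast
qed

text \<open>On \<open>{t..t+1}\<close> the weight is at least \<open>W K t\<close> and the
  exponential at least its value at t+1, so the finite integral bounds their product. The unit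
  length costs only the factor \<open>exp \<mu>\<close>.\<close>

lemma weight_exp_bound:
  assumes W: "weight_function_system W" and eps: "cond_epsilon0 W" and \<mu>: "\<mu> > 0"
  shows "\<exists>C\<ge>0. \<forall>t\<ge>0. W K t \<le> C * exp (\<mu> * t)"
proof -
  have w: "weight_function (W K)"
    using W by (simp add: weight_function_system_def)
  have fin: "(\<integral>\<^sup>+t\<in>{0..}. ennreal (W K t * exp (- \<mu> * t)) \<partial>lborel) < \<infinity>"
    using eps \<mu> by (simp add: cond_epsilon0_def)
  obtain I where I: "I \<ge> 0" "(\<integral>\<^sup>+t\<in>{0..}. ennreal (W K t * exp (- \<mu> * t)) \<partial>lborel) = ennreal I"
    using fin by (cases "\<integral>\<^sup>+t\<in>{0..}. ennreal (W K t * exp (- \<mu> * t)) \<partial>lborel" rule: ennreal_cases) auto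
  have "W K t \<le> I * exp \<mu> * exp (\<mu> * t)" if t: "t \<ge> 0" for t
  proof -
    have "ennreal ((W K t * exp (- \<mu> * (t + 1))) * ((t + 1) - t))
        \<le> (\<integral>\<^sup>+t\<in>{0..}. ennreal (W K t * exp (- \<mu> * t)) \<partial>lborel)"
    proof (rule nn_integral_ge_interval)
      fix s assume s: "t \<le> s" "s \<le> t + 1"
      then show "W K t * exp (- \<mu> * (t + 1)) \<le> W K s * exp (- \<mu> * s)"
        using weight_function_mono[OF w t s(1)] weight_function_nonneg[OF w, of s] t \<mu>
        by (intro mult_mono) auto
    qed (use t in auto)
    then have "W K t * exp (- \<mu> * (t + 1)) \<le> I"
      using I by (simp add: ennreal_le_iff)
    then have "W K t * exp (- \<mu> * (t + 1)) * exp (\<mu> * (t + 1)) \<le> I * exp (\<mu> * (t + 1))"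
      by (intro mult_right_mono) auto
    then show ?thesis
      by (simp add: mult.assoc ring_distribs flip: exp_add)
        (simp add: exp_add mult_ac)
  qed
  then show ?thesis using I by (intro exI[of _ "I * exp \<mu>"]) auto
qed

subsection \<open>Partial derivatives of holomorphic functions\<close>

text \<open>\<open>h\<close> is tied to \<open>g\<close> on \<open>S\<close> only: an iterated
  partial derivative is known to be a multiple of a complex derivative just there, and the next
  derivative must be taken from that knowledge.\<close>

lemma partial_xy_holomorphic:
  assumes S: "open S" "z \<in> S" and g: "g holomorphic_on S" and eq: "\<And>z. z \<in> S \<Longrightarrow> h z = g z"
  shows "partial_x h z = deriv g z" "partial_y h z = \<i> * deriv g z"
proof -
  have h: "h holomorphic_on S"
    using g by (rule holomorphic_transform) (simp add: eq)
  then have "(h has_field_derivative deriv h z) (at z)"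
    using h S by (metis holomorphic_derivI)
  moreover have "deriv h z = deriv g z"
    using h g S eq by (rule complex_derivative_transform_within_open)
  ultimately have h: "(h has_field_derivative deriv g z) (at z)" by simp
  have "((\<lambda>t. z + c * of_real t) has_vector_derivative c) (at 0)" for c
    by (auto intro!: derivative_eq_intros simp: has_vector_derivative_def scaleR_conv_of_real mult.commute)
  then have *: "((h \<circ> (\<lambda>t. z + c * of_real t)) has_vector_derivative (c * deriv g z)) (at 0)" for c
    by (rule field_vector_diff_chain_at) (use h in simp)
  show "partial_x h z = deriv g z"
    using vector_derivative_at[OF *[of 1]] by (simp add: partial_x_def o_def)
  show "partial_y h z = \<i> * deriv g z"
    using vector_derivative_at[OF *[of \<i>]] by (simp add: partial_y_def o_def)
qed

text \<open>Each derivative in y amounts to a complex derivative times \<i>, a factor of modulus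
  one. So only the total order counts, and Cauchy's estimates control every multi-index.\<close>

lemma norm_partial_deriv:
  assumes S: "open S" "z \<in> S" and f: "f holomorphic_on S"
  shows "norm (partial_deriv \<alpha> f z) = norm ((deriv ^^ (fst \<alpha> + snd \<alpha>)) f z)"
proof -
  have d: "(deriv ^^ k) f holomorphic_on S" for k
    using f S by (intro holomorphic_higher_deriv)
  have dc: "deriv (\<lambda>z. c * (deriv ^^ k) f z) z = c * (deriv ^^ (Suc k)) f z" if "z \<in> S" for c k z
    using holomorphic_on_imp_differentiable_at[OF d S(1) that] by (simp add: deriv_cmult)
  have y: "(partial_y ^^ n) f z = \<i> ^ n * (deriv ^^ n) f z" if "z \<in> S" for n z
    using that
  proof (induction n arbitrary: z)
    case (Suc n)
    have "partial_y ((partial_y ^^ n) f) z = \<i> * deriv (\<lambda>z. \<i> ^ n * (deriv ^^ n) f z) z"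
      by (rule partial_xy_holomorphic(2)[OF S(1) Suc.prems])
        (auto simp: Suc.IH intro!: holomorphic_on_mult d)
    then show ?case using dc[OF Suc.prems] by simp
  qed simp
  have "(partial_x ^^ m) ((partial_y ^^ n) f) z = \<i> ^ n * (deriv ^^ (m + n)) f z"
    if "z \<in> S" for m n z
    using that
  proof (induction m arbitrary: z)
    case (Suc m)
    have "partial_x ((partial_x ^^ m) ((partial_y ^^ n) f)) z
        = deriv (\<lambda>z. \<i> ^ n * (deriv ^^ (m + n)) f z) z"
      by (rule partial_xy_holomorphic(1)[OF S(1) Suc.prems])
        (auto simp: Suc.IH intro!: holomorphic_on_mult d)
    then show ?case using dc[OF Suc.prems] by simp
  qed (simp add: y)
  then show ?thesis
    using S by (simp add: partial_deriv_def norm_mult norm_power)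
qed

subsection \<open>Pushing the singularities of a function upwards\<close>

definition subgraph :: "(real \<Rightarrow> real) \<Rightarrow> real \<Rightarrow> complex set" where
  "subgraph \<phi> s = {z. Im z < \<phi> (Re z) + s}"

text \<open>Boundedness is asked for strictly below the level \<open>s\<close> only, which makes the
  class closed under differentiation.\<close>

definition bdd_hol :: "(real \<Rightarrow> real) \<Rightarrow> real \<Rightarrow> (complex \<Rightarrow> complex) set" where
  "bdd_hol \<phi> s = {f. f holomorphic_on subgraph \<phi> s \<and> (\<forall>t<s. bounded (f ` subgraph \<phi> t))}"

lemma subgraph_mono: "s \<le> t \<Longrightarrow> subgraph \<phi> s \<subseteq> subgraph \<phi> t"
  by (auto simp: subgraph_def)

lemma open_subgraph:
  assumes "uniformly_continuous_on UNIV \<phi>"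
  shows "open (subgraph \<phi> s)"
proof -
  have "continuous_on UNIV \<phi>"
    using assms by (rule uniformly_continuous_imp_continuous)
  then have "continuous_on UNIV (\<lambda>z. \<phi> (Re z))"
    by (rule continuous_on_compose2) (auto intro: continuous_intros)
  then show ?thesis
    unfolding subgraph_def by (intro open_Collect_less continuous_intros)
qed

text \<open>Uniform continuity yields one radius for all points and all levels. This keeps the step
  length from shrinking while a domain is raised repeatedly.\<close>

lemma subgraph_cball:
  assumes u: "uniformly_continuous_on UNIV \<phi>" and d: "d > 0"
  obtains r where "r > 0" "\<And>s z. z \<in> subgraph \<phi> s \<Longrightarrow> cball z r \<subseteq> subgraph \<phi> (s + d)"
proof -
  obtain \<delta> where \<delta>: "\<delta> > 0" "\<And>x y. dist y x < \<delta> \<Longrightarrow> dist (\<phi> y) (\<phi> x) < d / 2"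
    using u d unfolding uniformly_continuous_on_def by (metis UNIV_I half_gt_zero)
  \<comment> \<open>One half of \<open>d\<close> absorbs the change of the imaginary part, the other
    half the change of \<open>\<phi>\<close>. Halving \<open>\<delta>\<close> gives the strict
    inequality on the closed disc.\<close>
  define r where "r = min (\<delta> / 2) (d / 2)"
  have "cball z r \<subseteq> subgraph \<phi> (s + d)" if z: "z \<in> subgraph \<phi> s" for s z
  proof
    fix w assume "w \<in> cball z r"
    then have "cmod (z - w) \<le> r" by (simp add: dist_norm)
    then have "\<bar>Re z - Re w\<bar> \<le> r" "\<bar>Im z - Im w\<bar> \<le> r"
      using abs_Re_le_cmod[of "z - w"] abs_Im_le_cmod[of "z - w"] by auto
    moreover from this have "dist (\<phi> (Re z)) (\<phi> (Re w)) < d / 2"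
      using \<delta> by (auto simp: r_def dist_real_def)
    moreover have "r \<le> d / 2" by (simp add: r_def)
    ultimately have "Im w \<le> Im z + d / 2" "\<phi> (Re z) < \<phi> (Re w) + d / 2"
      unfolding dist_real_def by linarith+
    then show "w \<in> subgraph \<phi> (s + d)"
      using z by (simp add: subgraph_def)
  qed
  moreover have "r > 0" using \<delta> d by (simp add: r_def)
  ultimately show ?thesis using that by blast
qed

text \<open>Cauchy's estimate on discs of a fixed radius that reach at most halfway from level t to
  level \<open>s\<close>, where \<open>f\<close> is still bounded.\<close>

lemma bdd_hol_deriv:
  assumes u: "uniformly_continuous_on UNIV \<phi>" and f: "f \<in> bdd_hol \<phi> s"
  shows "(deriv ^^ k) f \<in> bdd_hol \<phi> s"
proof -
  have hol: "f holomorphic_on subgraph \<phi> s" using f by (simp add: bdd_hol_def)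
  have "bounded ((deriv ^^ k) f ` subgraph \<phi> t)" if t: "t < s" for t
  proof -
    obtain r where r: "r > 0" "\<And>z. z \<in> subgraph \<phi> t \<Longrightarrow> cball z r \<subseteq> subgraph \<phi> (t + (s - t) / 2)"
      using subgraph_cball[OF u, of "(s - t) / 2"] t by (metis diff_gt_0_iff_gt half_gt_zero)
    have "bounded (f ` subgraph \<phi> (t + (s - t) / 2))"
      using f t by (auto simp: bdd_hol_def field_simps)
    then obtain B where B: "\<And>z. z \<in> subgraph \<phi> (t + (s - t) / 2) \<Longrightarrow> norm (f z) \<le> B"
      by (auto simp: bounded_iff)
    have "norm ((deriv ^^ k) f z) \<le> fact k * B / r ^ k" if z: "z \<in> subgraph \<phi> t" for z
    proof (rule Cauchy_inequality)
      have "cball z r \<subseteq> subgraph \<phi> s"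
        using r(2)[OF z] subgraph_mono[of "t + (s - t) / 2" s \<phi>] t by (auto simp: field_simps)
      then have c: "f holomorphic_on cball z r"
        using hol holomorphic_on_subset by blast
      then show "continuous_on (cball z r) f" by (rule holomorphic_on_imp_continuous_on)
      show "f holomorphic_on ball z r"
        using c by (rule holomorphic_on_subset) auto
      show "norm (f x) \<le> B" if "norm (z - x) = r" for x
        using r(2)[OF z] that B by (auto simp: subset_iff dist_norm)
    qed (use r in auto)
    then show ?thesis by (auto simp: bounded_iff)
  qed
  moreover have "(deriv ^^ k) f holomorphic_on subgraph \<phi> s"
    using hol open_subgraph[OF u] by (rule holomorphic_higher_deriv)
  ultimately show ?thesis by (simp add: bdd_hol_def)
qed

lemma bdd_hol_translate:
  assumes f: "f \<in> bdd_hol \<phi> s"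
  shows "(\<lambda>z. f (z - \<i> * of_real \<tau>)) \<in> bdd_hol \<phi> (s + \<tau>)"
proof -
  have sub: "(\<lambda>z. z - \<i> * of_real \<tau>) ` subgraph \<phi> (t + \<tau>) \<subseteq> subgraph \<phi> t" for t
    by (auto simp: subgraph_def)
  have "(f \<circ> (\<lambda>z. z - \<i> * of_real \<tau>)) holomorphic_on subgraph \<phi> (s + \<tau>)"
    by (rule holomorphic_on_compose_gen[OF _ _ sub]) (use f in \<open>auto simp: bdd_hol_def intro!: holomorphic_intros\<close>)
  moreover have "bounded ((\<lambda>z. f (z - \<i> * of_real \<tau>)) ` subgraph \<phi> t)" if "t < s + \<tau>" for t
  proof (rule bounded_subset)
    show "bounded (f ` subgraph \<phi> (t - \<tau>))" using f that by (simp add: bdd_hol_def)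
    show "(\<lambda>z. f (z - \<i> * of_real \<tau>)) ` subgraph \<phi> t \<subseteq> f ` subgraph \<phi> (t - \<tau>)"
      using sub[of "t - \<tau>"] by auto
  qed
  ultimately show ?thesis by (simp add: bdd_hol_def o_def)
qed

lemma bdd_hol_cmult: "f \<in> bdd_hol \<phi> s \<Longrightarrow> (\<lambda>z. f z * c) \<in> bdd_hol \<phi> s"
proof -
  assume f: "f \<in> bdd_hol \<phi> s"
  have "bounded ((\<lambda>z. f z * c) ` subgraph \<phi> t)" if t: "t < s" for t
  proof -
    have "bounded (f ` subgraph \<phi> t)" using f t by (simp add: bdd_hol_def)
    then have "bounded ((\<lambda>w. w * c) ` (f ` subgraph \<phi> t))"
      using bounded_linear_mult_left by (rule bounded_linear_image)
    then show ?thesis by (simp add: image_image)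
  qed
  then show ?thesis using f by (auto simp: bdd_hol_def intro!: holomorphic_intros)
qed

lemma bdd_hol_sum:
  assumes "finite A" "\<And>i. i \<in> A \<Longrightarrow> f i \<in> bdd_hol \<phi> s"
  shows "(\<lambda>z. \<Sum>i\<in>A. f i z) \<in> bdd_hol \<phi> s"
  using assms
proof (induction A rule: finite_induct)
  case empty
  then show ?case by (auto simp: bdd_hol_def bounded_iff)
next
  case (insert x A)
  then have "(\<lambda>z. \<Sum>i\<in>A. f i z) \<in> bdd_hol \<phi> s" "f x \<in> bdd_hol \<phi> s" by auto
  then show ?case
    using insert by (auto simp: bdd_hol_def intro!: holomorphic_intros bounded_plus_comp)
qed

text \<open>The approximant is a Taylor polynomial of \<open>f\<close> about the point \<open>\<i> * \<tau>\<close> below the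
  argument; it converges uniformly because \<open>f\<close> is bounded on the disc of radius \<open>2 * \<tau>\<close>
  around that point.\<close>

lemma bdd_hol_push:
  assumes u: "uniformly_continuous_on UNIV \<phi>" and d: "d > 0" and \<tau>: "\<tau> > 0"
    and ball: "\<And>s z. z \<in> subgraph \<phi> s \<Longrightarrow> cball z (3 * \<tau>) \<subseteq> subgraph \<phi> (s + d / 2)"
    and f: "f \<in> bdd_hol \<phi> (s + d)" and e: "e > 0"
  shows "\<exists>h\<in>bdd_hol \<phi> (s + d + \<tau>). \<forall>z\<in>subgraph \<phi> s. norm (f z - h z) \<le> e"
proof -
  define v where "v = \<i> * complex_of_real \<tau>"
  have normv: "norm v = \<tau>" using \<tau> by (simp add: v_def norm_mult)
  have "bounded (f ` subgraph \<phi> (s + d / 2))" using f d by (simp add: bdd_hol_def)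
  then obtain B where B: "B > 0" "\<And>z. z \<in> subgraph \<phi> (s + d / 2) \<Longrightarrow> norm (f z) \<le> B"
    by (auto simp: bounded_pos)
  \<comment> \<open>This is the tail from index n on of the geometric series that will dominate the
    Taylor series.\<close>
  have "(\<lambda>n. B * 2 * (1/2) ^ n) \<longlonglongrightarrow> B * 2 * 0"
    by (intro tendsto_intros LIMSEQ_power_zero) auto
  then have "eventually (\<lambda>n. B * 2 * (1/2) ^ n < e) sequentially"
    using e by (simp add: order_tendsto_iff)
  then obtain n where n: "B * 2 * (1/2) ^ n \<le> e"
    by (auto simp: eventually_sequentially intro: less_imp_le)
  \<comment> \<open>The centre moves along with z, so the powers of the offset \<open>v\<close> are
    constants and \<open>h\<close> is a finite linear combination of translated derivatives.\<close>
  define h where "h = (\<lambda>z. \<Sum>k<n. (deriv ^^ k) f (z - v) * (v ^ k / fact k))"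
  have "(\<lambda>z. (deriv ^^ k) f (z - v)) \<in> bdd_hol \<phi> (s + d + \<tau>)" for k
    unfolding v_def by (rule bdd_hol_translate[OF bdd_hol_deriv[OF u f]])
  then have "(\<lambda>z. (deriv ^^ k) f (z - v) * (v ^ k / fact k)) \<in> bdd_hol \<phi> (s + d + \<tau>)" for k
    by (rule bdd_hol_cmult)
  then have "h \<in> bdd_hol \<phi> (s + d + \<tau>)"
    unfolding h_def by (intro bdd_hol_sum) auto
  moreover have "norm (f z - h z) \<le> e" if z: "z \<in> subgraph \<phi> s" for z
  proof -
    \<comment> \<open>The centre is at distance \<tau> from z, whence the radius 3\<tau> in the
      hypothesis. The quotient of \<tau> and 2\<tau> is the ratio 1/2 of the series.\<close>
    have sub: "cball (z - v) (2 * \<tau>) \<subseteq> subgraph \<phi> (s + d / 2)"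
    proof
      fix w assume "w \<in> cball (z - v) (2 * \<tau>)"
      then have "dist z w \<le> 3 * \<tau>"
        using dist_triangle[of z w "z - v"] normv by (simp add: dist_norm)
      then show "w \<in> subgraph \<phi> (s + d / 2)" using ball[OF z] by auto
    qed
    have hol: "f holomorphic_on cball (z - v) (2 * \<tau>)"
      using f sub subgraph_mono[of "s + d / 2" "s + d" \<phi>] d
      by (auto simp: bdd_hol_def intro: holomorphic_on_subset)
    have bound: "norm ((deriv ^^ k) f (z - v)) \<le> fact k * B / (2 * \<tau>) ^ k" for k
    proof (rule Cauchy_inequality)
      show "continuous_on (cball (z - v) (2 * \<tau>)) f"
        using hol by (rule holomorphic_on_imp_continuous_on)
      show "f holomorphic_on ball (z - v) (2 * \<tau>)"
        using hol by (rule holomorphic_on_subset) auto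
      show "norm (f x) \<le> B" if "norm (z - v - x) = 2 * \<tau>" for x
        using sub that B(2) by (auto simp: subset_iff dist_norm)
    qed (use \<tau> in auto)
    define a where "a = (\<lambda>k. (deriv ^^ k) f (z - v) * (v ^ k / fact k))"
    have "(\<lambda>k. (deriv ^^ k) f (z - v) / fact k * (z - (z - v)) ^ k) sums f z"
      by (rule holomorphic_power_series[of _ _ "2 * \<tau>"])
        (use hol \<tau> normv in \<open>auto simp: dist_norm intro: holomorphic_on_subset\<close>)
    then have a: "a sums f z" by (simp add: a_def field_simps)
    have na: "norm (a k) \<le> B * (1/2) ^ k" for k
    proof -
      have "norm (a k) = norm ((deriv ^^ k) f (z - v)) * (\<tau> ^ k / fact k)"
        by (simp add: a_def norm_mult norm_divide norm_power normv)
      also have "\<dots> \<le> (fact k * B / (2 * \<tau>) ^ k) * (\<tau> ^ k / fact k)"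
        using bound \<tau> by (intro mult_right_mono) auto
      also have "\<dots> = B * (1/2) ^ k" using \<tau> by (simp add: field_simps)
      finally show ?thesis .
    qed
    have geo: "(\<lambda>k. B * (1/2) ^ (k + n)) sums (B * 2 * (1/2) ^ n)"
      using sums_mult[OF geometric_sums[of "1/2::real"], of "B * (1/2) ^ n"]
      by (simp add: power_add mult_ac)
    have "f z - h z = (\<Sum>k. a (k + n))"
      using a suminf_minus_initial_segment[of a n] by (auto simp: sums_iff h_def a_def)
    also have "norm \<dots> \<le> (\<Sum>k. B * (1/2) ^ (k + n))"
      by (rule norm_suminf_le) (use geo na in \<open>auto simp: sums_iff\<close>)
    also have "\<dots> \<le> e" using geo n by (simp add: sums_iff)
    finally show ?thesis .
  qed
  ultimately show ?thesis by blast
qed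

text \<open>Finitely many upward pushes. The level at which the error is controlled rises together
  with the domain, so their gap \<open>d\<close>, and with it the step \<tau>, stays the
  same.\<close>

lemma bdd_hol_approx:
  assumes u: "uniformly_continuous_on UNIV \<phi>" and s: "s\<^sub>0 < s\<^sub>1"
    and f: "f \<in> bdd_hol \<phi> s\<^sub>1" and e: "e > 0"
  shows "\<exists>h\<in>bdd_hol \<phi> s\<^sub>2. \<forall>z\<in>subgraph \<phi> s\<^sub>0. norm (f z - h z) \<le> e"
proof -
  define d where "d = s\<^sub>1 - s\<^sub>0"
  have d: "d > 0" using s by (simp add: d_def)
  obtain r where r: "r > 0" "\<And>s z. z \<in> subgraph \<phi> s \<Longrightarrow> cball z r \<subseteq> subgraph \<phi> (s + d / 2)"
    using subgraph_cball[OF u, of "d / 2"] d by (metis half_gt_zero)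
  define \<tau> where "\<tau> = r / 3"
  have \<tau>: "\<tau> > 0" "\<And>s z. z \<in> subgraph \<phi> s \<Longrightarrow> cball z (3 * \<tau>) \<subseteq> subgraph \<phi> (s + d / 2)"
    using r by (auto simp: \<tau>_def)
  \<comment> \<open>The tolerance is general because each step spends half of it on the induction
    hypothesis and half on the new push.\<close>
  have step: "\<exists>h\<in>bdd_hol \<phi> (s\<^sub>1 + real j * \<tau>). \<forall>z\<in>subgraph \<phi> s\<^sub>0. norm (f z - h z) \<le> e'" if "e' > 0" for j e'
    using that
  proof (induction j arbitrary: e')
    case 0
    then show ?case using f by (intro bexI[of _ f]) auto
  next
    case (Suc j)
    obtain g where g: "g \<in> bdd_hol \<phi> (s\<^sub>1 + real j * \<tau>)" "\<forall>z\<in>subgraph \<phi> s\<^sub>0. norm (f z - g z) \<le> e' / 2"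
      using Suc.IH[of "e' / 2"] Suc.prems by auto
    have "s\<^sub>1 + real j * \<tau> = (s\<^sub>0 + real j * \<tau>) + d" by (simp add: d_def)
    then have "g \<in> bdd_hol \<phi> ((s\<^sub>0 + real j * \<tau>) + d)" using g(1) by metis
    from bdd_hol_push[OF u d \<tau> this, of "e' / 2"] Suc.prems
    obtain h where h: "h \<in> bdd_hol \<phi> ((s\<^sub>0 + real j * \<tau>) + d + \<tau>)"
        "\<forall>z\<in>subgraph \<phi> (s\<^sub>0 + real j * \<tau>). norm (g z - h z) \<le> e' / 2"
      by auto
    have "norm (f z - h z) \<le> e'" if "z \<in> subgraph \<phi> s\<^sub>0" for z
    proof -
      have "z \<in> subgraph \<phi> (s\<^sub>0 + real j * \<tau>)"
        using that subgraph_mono[of s\<^sub>0 "s\<^sub>0 + real j * \<tau>" \<phi>] \<tau> by auto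
      then show ?thesis
        using g h that norm_triangle_ineq[of "f z - g z" "g z - h z"] by force
    qed
    moreover have "(s\<^sub>0 + real j * \<tau>) + d + \<tau> = s\<^sub>1 + real (Suc j) * \<tau>"
      by (simp add: d_def algebra_simps)
    ultimately show ?case using h by (metis (no_types, lifting))
  qed
  obtain j :: nat where j: "real j * \<tau> > s\<^sub>2 - s\<^sub>1"
    using \<tau>(1) reals_Archimedean3 by blast
  obtain h where h: "h \<in> bdd_hol \<phi> (s\<^sub>1 + real j * \<tau>)" "\<forall>z\<in>subgraph \<phi> s\<^sub>0. norm (f z - h z) \<le> e"
    using step[OF e] by blast
  moreover have "h \<in> bdd_hol \<phi> s\<^sub>2"
    using h(1) j subgraph_mono[of s\<^sub>2 "s\<^sub>1 + real j * \<tau>" \<phi>]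
    by (auto simp: bdd_hol_def intro: holomorphic_on_subset)
  ultimately show ?thesis by blast
qed

subsection \<open>Splitting a function along the real line\<close>

lemma holomorphic_Cauchy_transform_linepath:
  assumes "continuous_on (closed_segment a b) f"
  shows "(\<lambda>z. contour_integral (linepath a b) (\<lambda>w. f w / (w - z))) holomorphic_on - closed_segment a b"
proof -
  \<comment> \<open>The exponent 1 matches the shape of \<open>Cauchy_next_derivative\<close>, which
    differentiates under the integral sign.\<close>
  have int: "((\<lambda>u. f u / (u - z) ^ 1) has_contour_integral
      contour_integral (linepath a b) (\<lambda>w. f w / (w - z))) (linepath a b)"
    if "z \<in> UNIV - path_image (linepath a b)" for z
  proof -
    have "continuous_on (closed_segment a b) (\<lambda>w. f w / (w - z))"
      using that assms by (auto intro!: continuous_intros)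
    then show ?thesis
      by (simp add: contour_integrable_continuous_linepath has_contour_integral_integral)
  qed
  have "((\<lambda>z. contour_integral (linepath a b) (\<lambda>w. f w / (w - z))) has_field_derivative
      (of_nat 1 * contour_integral (linepath a b) (\<lambda>u. f u / (u - z) ^ Suc 1))) (at z)"
    if "z \<in> - closed_segment a b" for z
    by (rule Cauchy_next_derivative(2)[where B = "norm (b - a)" and S = UNIV, OF _ _ int])
      (use that assms in auto)
  then show ?thesis
    by (subst holomorphic_on_open) (auto simp: closed_segment open_Compl)
qed

text \<open>Lengthening the segment by one unit at both ends changes the integral by
  O(exp(-n)/\<rho>), uniformly at distance at least \<rho> from the line. The Weierstrass M-test
  then gives a locally uniform limit, which is holomorphic and bounded away from the line.\<close>

lemma Cauchy_transform_line:
  fixes f :: "complex \<Rightarrow> complex"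
  assumes cont: "continuous_on {w. Im w = y} f"
    and decay: "\<And>w. Im w = y \<Longrightarrow> norm (f w) \<le> C * exp (- \<bar>Re w\<bar>)"
  obtains T where "T holomorphic_on {z. Im z \<noteq> y}"
    "\<And>z. Im z \<noteq> y \<Longrightarrow> (\<lambda>n. contour_integral (linepath (Complex (- real n) y) (Complex (real n) y))
        (\<lambda>w. f w / (w - z))) \<longlonglongrightarrow> T z"
    "\<And>\<rho>. \<rho> > 0 \<Longrightarrow> \<exists>B. \<forall>z. \<rho> \<le> \<bar>Im z - y\<bar> \<longrightarrow> norm (T z) \<le> B"
proof -
  define I where "I = (\<lambda>n z. contour_integral (linepath (Complex (- real n) y) (Complex (real n) y))
        (\<lambda>w. f w / (w - z)))"
  have seg: "closed_segment (Complex a y) (Complex b y) = {w. Im w = y \<and> Re w \<in> {a..b}}"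
    if "a \<le> b" for a b
    using that by (subst closed_segment_same_Im) (auto simp: closed_segment_eq_real_ivl)
  have C: "C \<ge> 0"
    using order_trans[OF norm_ge_zero decay[of "Complex 0 y"]] by simp
  have cont': "continuous_on (closed_segment (Complex a y) (Complex b y)) (\<lambda>w. f w / (w - z))"
    if "a \<le> b" "Im z \<noteq> y" for a b z
    using that by (intro continuous_intros continuous_on_subset[OF cont]) (auto simp: seg)
  have piece: "norm (contour_integral (linepath (Complex a y) (Complex (a + 1) y)) (\<lambda>w. f w / (w - z)))
      \<le> C * exp (- m) / \<rho>"
    if "\<rho> > 0" "\<rho> \<le> \<bar>Im z - y\<bar>" and m: "\<And>x. a \<le> x \<Longrightarrow> x \<le> a + 1 \<Longrightarrow> m \<le> \<bar>x\<bar>" for a m z \<rho>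
  proof -
    have "norm (contour_integral (linepath (Complex a y) (Complex (a + 1) y)) (\<lambda>w. f w / (w - z)))
      \<le> (C * exp (- m) / \<rho>) * norm (Complex (a + 1) y - Complex a y)"
    proof (rule contour_integral_bound_linepath)
      fix w assume "w \<in> closed_segment (Complex a y) (Complex (a + 1) y)"
      then have w: "Im w = y" "a \<le> Re w" "Re w \<le> a + 1" by (auto simp: seg)
      have "\<rho> \<le> norm (w - z)"
        using abs_Im_le_cmod[of "w - z"] w that by simp
      moreover have "norm (f w) \<le> C * exp (- m)"
        by (rule order_trans[OF decay[OF w(1)]]) (use m[OF w(2,3)] C in \<open>auto intro!: mult_left_mono\<close>)
      ultimately show "norm (f w / (w - z)) \<le> C * exp (- m) / \<rho>"
        using that C by (simp add: norm_divide frac_le)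
    next
      show "(\<lambda>w. f w / (w - z)) contour_integrable_on linepath (Complex a y) (Complex (a + 1) y)"
        using that by (intro contour_integrable_continuous_linepath cont') auto
    qed (use C that in auto)
    then show ?thesis by (simp add: complex_diff norm_complex_def)
  qed
  have diff: "I (Suc k) z - I k z = contour_integral (linepath (Complex (- real k - 1) y) (Complex (- real k) y)) (\<lambda>w. f w / (w - z))
      + contour_integral (linepath (Complex (real k) y) (Complex (real k + 1) y)) (\<lambda>w. f w / (w - z))"
    if z: "Im z \<noteq> y" for k z
  proof -
    have "I (Suc k) z = contour_integral (linepath (Complex (- real k - 1) y) (Complex (- real k) y)) (\<lambda>w. f w / (w - z))
      + contour_integral (linepath (Complex (- real k) y) (Complex (real k + 1) y)) (\<lambda>w. f w / (w - z))"
      using contour_integral_split_linepath[OF cont'[of "- real k - 1" "real k + 1" z], of "Complex (- real k) y"] z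
      by (simp add: I_def seg minus_diff_commute add.commute[of _ 1])
    also have "contour_integral (linepath (Complex (- real k) y) (Complex (real k + 1) y)) (\<lambda>w. f w / (w - z))
      = I k z + contour_integral (linepath (Complex (real k) y) (Complex (real k + 1) y)) (\<lambda>w. f w / (w - z))"
      using contour_integral_split_linepath[OF cont'[of "- real k" "real k + 1" z], of "Complex (real k) y"] z
      by (simp add: I_def seg)
    finally show ?thesis by simp
  qed
  \<comment> \<open>A geometric majorant; the 2 counts the two end pieces.\<close>
  define M where "M = (\<lambda>\<rho> k. 2 * C / \<rho> * exp (- 1) ^ k)"
  have M: "summable (M \<rho>)" for \<rho>
    unfolding M_def by (intro summable_mult summable_geometric) simp
  have bound: "norm (I (Suc k) z - I k z) \<le> M \<rho> k" if \<rho>: "\<rho> > 0" "\<rho> \<le> \<bar>Im z - y\<bar>" for k z \<rho>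
  proof -
    have 1: "norm (contour_integral (linepath (Complex (- real k - 1) y) (Complex (- real k) y)) (\<lambda>w. f w / (w - z)))
        \<le> C * exp (- real k) / \<rho>"
      using piece[OF \<rho>, of "- real k - 1" "real k"] by simp
    have 2: "norm (contour_integral (linepath (Complex (real k) y) (Complex (real k + 1) y)) (\<lambda>w. f w / (w - z)))
        \<le> C * exp (- real k) / \<rho>"
      using piece[OF \<rho>, of "real k" "real k"] by simp
    have "Im z \<noteq> y" using \<rho> by auto
    then have "norm (I (Suc k) z - I k z) \<le> C * exp (- real k) / \<rho> + C * exp (- real k) / \<rho>"
      unfolding diff[OF \<open>Im z \<noteq> y\<close>] using 1 2 norm_triangle_mono by blast
    also have "\<dots> = M \<rho> k" by (simp add: M_def exp_of_nat_mult[symmetric])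
    finally show ?thesis .
  qed
  \<comment> \<open>The segment for 0 is a single point, so the telescoping sum has no initial
    term.\<close>
  have I0: "I 0 z = 0" for z by (simp add: I_def)
  have tele: "(\<Sum>k<n. I (Suc k) z - I k z) = I n z" for n z
    by (induction n) (auto simp: I0)
  define T where "T = (\<lambda>z. \<Sum>k. I (Suc k) z - I k z)"
  have unif: "uniform_limit {z. \<rho> \<le> \<bar>Im z - y\<bar>} I T sequentially" if "\<rho> > 0" for \<rho>
    using Weierstrass_m_test[of "{z. \<rho> \<le> \<bar>Im z - y\<bar>}" "\<lambda>k z. I (Suc k) z - I k z" "M \<rho>"] bound[OF that] M
    by (simp add: tele T_def)
  have opn: "open {z. Im z \<noteq> y}"
    by (intro open_Collect_neq continuous_intros)
  show ?thesis
  proof (rule that[of T])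
    show "T holomorphic_on {z. Im z \<noteq> y}"
    proof (rule holomorphic_uniform_sequence[OF opn, of I])
      fix n
      have "I n holomorphic_on - closed_segment (Complex (- real n) y) (Complex (real n) y)"
        unfolding I_def
        by (rule holomorphic_Cauchy_transform_linepath[OF continuous_on_subset[OF cont]]) (auto simp: seg)
      then show "I n holomorphic_on {z. Im z \<noteq> y}"
        by (rule holomorphic_on_subset) (auto simp: seg)
    next
      fix x assume "x \<in> {z. Im z \<noteq> y}"
      then have d: "\<bar>Im x - y\<bar> / 2 > 0" by simp
      have sub: "cball x (\<bar>Im x - y\<bar> / 2) \<subseteq> {z. \<bar>Im x - y\<bar> / 2 \<le> \<bar>Im z - y\<bar>}"
      proof
        fix z assume "z \<in> cball x (\<bar>Im x - y\<bar> / 2)"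
        then have "\<bar>Im x - Im z\<bar> \<le> \<bar>Im x - y\<bar> / 2"
          using abs_Im_le_cmod[of "x - z"] by (simp add: dist_norm)
        then show "z \<in> {z. \<bar>Im x - y\<bar> / 2 \<le> \<bar>Im z - y\<bar>}"
          by (simp add: abs_if split: if_splits)
      qed
      then have "cball x (\<bar>Im x - y\<bar> / 2) \<subseteq> {z. Im z \<noteq> y}" using d by auto
      moreover have "uniform_limit (cball x (\<bar>Im x - y\<bar> / 2)) I T sequentially"
        using unif[OF d] sub by (rule uniform_limit_on_subset)
      ultimately show "\<exists>d>0. cball x d \<subseteq> {z. Im z \<noteq> y} \<and> uniform_limit (cball x d) I T sequentially"
        using d by blast
    qed
    show "(\<lambda>n. contour_integral (linepath (Complex (- real n) y) (Complex (real n) y))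
        (\<lambda>w. f w / (w - z))) \<longlonglongrightarrow> T z" if "Im z \<noteq> y" for z
      using tendsto_uniform_limitI[OF unif[of "\<bar>Im z - y\<bar>"], of z] that by (simp add: I_def)
    show "\<exists>B. \<forall>z. \<rho> \<le> \<bar>Im z - y\<bar> \<longrightarrow> norm (T z) \<le> B" if "\<rho> > 0" for \<rho>
      unfolding T_def using bound[OF that] M[of \<rho>]
      by (intro exI[of _ "suminf (M \<rho>)"]) (auto intro!: norm_suminf_le)
  qed
qed

text \<open>Cauchy's formula on the rectangle with real parts between -n and n. The vertical sides
  vanish in the limit by the decay of \<open>f\<close>; the top side is traversed leftwards, whence
  the sign of \<open>t\<close>.\<close>

lemma Cauchy_formula_strip:
  assumes \<eta>: "0 < \<eta>" and S: "open S" and strip: "\<And>z. \<bar>Im z\<bar> \<le> \<eta> \<Longrightarrow> z \<in> S"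
    and f: "f holomorphic_on S"
    and decay: "\<And>z. \<bar>Im z\<bar> \<le> \<eta> \<Longrightarrow> norm (f z) \<le> C * exp (- \<bar>Re z\<bar>)"
    and z: "\<bar>Im z\<bar> < \<eta>"
    and bot: "(\<lambda>n. contour_integral (linepath (Complex (- real n) (- \<eta>)) (Complex (real n) (- \<eta>)))
        (\<lambda>w. f w / (w - z))) \<longlonglongrightarrow> b"
    and top: "(\<lambda>n. contour_integral (linepath (Complex (- real n) \<eta>) (Complex (real n) \<eta>))
        (\<lambda>w. f w / (w - z))) \<longlonglongrightarrow> t"
  shows "b - t = 2 * pi * \<i> * f z"
proof -
  define g where "g = (\<lambda>w. f w / (w - z))"
  have C: "C \<ge> 0"
    using order_trans[OF norm_ge_zero decay[of 0]] \<eta> by simp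
  define side where "side = (\<lambda>x. contour_integral (linepath (Complex x (- \<eta>)) (Complex x \<eta>)) g)"
  have seg: "closed_segment (Complex x (- \<eta>)) (Complex x \<eta>) = {w. Re w = x \<and> \<bar>Im w\<bar> \<le> \<eta>}" for x
    using \<eta> by (subst closed_segment_same_Re) (auto simp: closed_segment_eq_real_ivl)
  have seg': "closed_segment (Complex (- real n) y) (Complex (real n) y) \<subseteq> {w. Im w = y}" for n y
    by (subst closed_segment_same_Im) auto
  have contf: "continuous_on S f" using f by (rule holomorphic_on_imp_continuous_on)
  have cont: "continuous_on A g" if "A \<subseteq> {w. \<bar>Im w\<bar> \<le> \<eta>}" "z \<notin> A" for A
    unfolding g_def using that strip
    by (intro continuous_intros continuous_on_subset[OF contf]) auto
  \<comment> \<open>The condition on x keeps the modulus of the denominator w - z at least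
    1.\<close>
  have side: "norm (side x) \<le> C * exp (- \<bar>x\<bar>) * (2 * \<eta>)" if "\<bar>x\<bar> \<ge> \<bar>Re z\<bar> + 1" for x
  proof -
    have "norm (side x) \<le> C * exp (- \<bar>x\<bar>) * norm (Complex x \<eta> - Complex x (- \<eta>))"
      unfolding side_def
    proof (rule contour_integral_bound_linepath)
      show "g contour_integrable_on linepath (Complex x (- \<eta>)) (Complex x \<eta>)"
        using that by (intro contour_integrable_continuous_linepath cont) (auto simp: seg)
    next
      fix w assume "w \<in> closed_segment (Complex x (- \<eta>)) (Complex x \<eta>)"
      then have w: "Re w = x" "\<bar>Im w\<bar> \<le> \<eta>" by (auto simp: seg)
      have "1 \<le> norm (w - z)"
        using abs_Re_le_cmod[of "w - z"] w that by simp
      then have "norm (g w) \<le> norm (f w) / 1"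
        unfolding g_def norm_divide by (intro divide_left_mono) auto
      then show "norm (g w) \<le> C * exp (- \<bar>x\<bar>)"
        using decay[OF w(2)] w by simp
    qed (use C in auto)
    also have "Complex x \<eta> - Complex x (- \<eta>) = \<i> * of_real (2 * \<eta>)"
      by (simp add: complex_eq_iff)
    finally show ?thesis using \<eta> by (simp add: norm_mult)
  qed
  have side0: "(\<lambda>n. side (s * real n)) \<longlonglongrightarrow> 0" if "\<bar>s\<bar> = 1" for s
  proof (rule Lim_null_comparison)
    show "eventually (\<lambda>n. norm (side (s * real n)) \<le> C * exp (- real n) * (2 * \<eta>)) sequentially"
      using eventually_ge_at_top[of "nat \<lceil>\<bar>Re z\<bar> + 1\<rceil>"]
    proof eventually_elim
      case (elim n)
      then have "\<bar>Re z\<bar> + 1 \<le> real n" by linarith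
      then show ?case using side[of "s * real n"] that by (simp add: abs_mult)
    qed
    have e0: "(\<lambda>n. exp (- real n) :: real) \<longlonglongrightarrow> 0"
      by (rule filterlim_compose[OF exp_at_bot filterlim_compose[OF filterlim_uminus_at_bot_at_top filterlim_real_sequentially]])
    show "(\<lambda>n. C * exp (- real n) * (2 * \<eta>)) \<longlonglongrightarrow> 0"
      using tendsto_mult[OF tendsto_mult[OF tendsto_const[of C] e0] tendsto_const[of "2 * \<eta>"]] by simp
  qed
  \<comment> \<open>The factors 1 and -1 are written out so that \<open>side0\<close> applies to
    both vertical sides.\<close>
  have eq: "eventually (\<lambda>n. contour_integral (linepath (Complex (- real n) (- \<eta>)) (Complex (real n) (- \<eta>))) g
      + side (1 * real n) - contour_integral (linepath (Complex (- real n) \<eta>) (Complex (real n) \<eta>)) g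
      - side ((- 1) * real n) = 2 * pi * \<i> * f z) sequentially"
    using eventually_ge_at_top[of "nat \<lceil>\<bar>Re z\<bar> + 1\<rceil>"]
  proof eventually_elim
    case (elim n)
    then have n: "\<bar>Re z\<bar> + 1 \<le> real n" by linarith
    define a1 where "a1 = Complex (- real n) (- \<eta>)"
    define a3 where "a3 = Complex (real n) \<eta>"
    let ?V = "{w. \<bar>Im w\<bar> \<le> \<eta>}"
    have V: "?V = {w. Im w \<ge> - \<eta>} \<inter> {w. Im w \<le> \<eta>}" by auto
    have conv: "convex ?V"
      unfolding V by (intro convex_Int convex_halfspace_Im_ge convex_halfspace_Im_le)
    have "open {w. \<bar>Im w\<bar> < \<eta>}" by (intro open_Collect_less continuous_intros)
    then have int: "z \<in> interior ?V"
      using z by (intro interiorI[of "{w. \<bar>Im w\<bar> < \<eta>}"]) auto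
    have path: "path_image (rectpath a1 a3) \<subseteq> ?V - {z}"
      using n \<eta> z by (subst path_image_rectpath) (auto simp: a1_def a3_def)
    have "(g has_contour_integral (2 * pi * \<i> * winding_number (rectpath a1 a3) z * f z)) (rectpath a1 a3)"
      unfolding g_def
      using strip by (intro Cauchy_integral_formula_convex_simple[OF conv _ int _ path] holomorphic_on_subset[OF f]) auto
    moreover have "winding_number (rectpath a1 a3) z = 1"
      using n \<eta> z by (intro winding_number_rectpath) (auto simp: in_box_complex_iff a1_def a3_def)
    ultimately have c: "contour_integral (rectpath a1 a3) g = 2 * pi * \<i> * f z"
      by (simp add: contour_integral_unique)
    have ci: "g contour_integrable_on linepath u v"
      if "closed_segment u v \<subseteq> ?V - {z}" for u v
      using that by (intro contour_integrable_continuous_linepath cont) auto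
    have i1: "g contour_integrable_on linepath (Complex (- real n) (- \<eta>)) (Complex (real n) (- \<eta>))"
      using seg'[of n "- \<eta>"] z \<eta> by (intro ci) auto
    have i3: "g contour_integrable_on linepath (Complex (- real n) \<eta>) (Complex (real n) \<eta>)"
      using seg'[of n "\<eta>"] z \<eta> by (intro ci) auto
    have i2: "g contour_integrable_on linepath (Complex x (- \<eta>)) (Complex x \<eta>)" if "\<bar>x\<bar> = real n" for x
      using n that by (intro ci) (auto simp: seg)
    have rev: "contour_integral (linepath v u) g = - contour_integral (linepath u v) g"
        "g contour_integrable_on linepath v u" if "g contour_integrable_on linepath u v" for u v
      using contour_integral_reversepath[of "linepath u v" g] contour_integrable_reversepath[of "linepath u v" g] that by auto
    have "contour_integral (rectpath a1 a3) g = contour_integral (linepath (Complex (- real n) (- \<eta>)) (Complex (real n) (- \<eta>))) g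
      + side (real n) - contour_integral (linepath (Complex (- real n) \<eta>) (Complex (real n) \<eta>)) g
      - side (- real n)"
      using rev[OF i3] rev[OF i2[of "- real n"]] i1 i2[of "real n"]
      by (simp add: rectpath_def Let_def a1_def a3_def side_def contour_integrable_joinI valid_path_join)
    then show ?case using c by simp
  qed
  have "(\<lambda>n. contour_integral (linepath (Complex (- real n) (- \<eta>)) (Complex (real n) (- \<eta>))) g
      + side (1 * real n) - contour_integral (linepath (Complex (- real n) \<eta>) (Complex (real n) \<eta>)) g
      - side ((- 1) * real n)) \<longlonglongrightarrow> b + 0 - t - 0"
    using bot top by (intro tendsto_intros side0) (auto simp: g_def)
  moreover have "(\<lambda>n. contour_integral (linepath (Complex (- real n) (- \<eta>)) (Complex (real n) (- \<eta>))) g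
      + side (1 * real n) - contour_integral (linepath (Complex (- real n) \<eta>) (Complex (real n) \<eta>)) g
      - side ((- 1) * real n)) \<longlonglongrightarrow> 2 * pi * \<i> * f z"
    by (rule tendsto_eventually[OF eq])
  ultimately show ?thesis using LIMSEQ_unique by fastforce
qed

text \<open>The Cauchy transforms from the lines at heights \<eta> and -\<eta> give
  \<open>P\<close>, holomorphic below the upper line, and \<open>Q\<close>, holomorphic above the
  lower one, with sum \<open>f\<close> in between. Then f - Q continues \<open>P\<close> upwards and
  f - P continues \<open>Q\<close> downwards within \<open>S\<close>.\<close>

lemma holomorphic_split_real_line:
  assumes \<eta>: "0 < \<eta>" and S: "open S" and strip: "\<And>z. \<bar>Im z\<bar> \<le> \<eta> \<Longrightarrow> z \<in> S"
    and f: "f holomorphic_on S" and bdd: "bounded (f ` S)"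
    and decay: "\<And>z. \<bar>Im z\<bar> \<le> \<eta> \<Longrightarrow> norm (f z) \<le> C * exp (- \<bar>Re z\<bar>)"
  obtains p q where "p holomorphic_on S \<union> {z. Im z < 0}" "q holomorphic_on S \<union> {z. Im z > 0}"
    "bounded (p ` (S \<union> {z. Im z < 0}))" "bounded (q ` (S \<union> {z. Im z > 0}))"
    "\<And>z. z \<in> S \<Longrightarrow> f z = p z + q z"
proof -
  have contf: "continuous_on S f" using f by (rule holomorphic_on_imp_continuous_on)
  obtain T where T: "T holomorphic_on {z. Im z \<noteq> \<eta>}"
    "\<And>z. Im z \<noteq> \<eta> \<Longrightarrow> (\<lambda>n. contour_integral (linepath (Complex (- real n) \<eta>) (Complex (real n) \<eta>))
        (\<lambda>w. f w / (w - z))) \<longlonglongrightarrow> T z"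
    "\<And>\<rho>. \<rho> > 0 \<Longrightarrow> \<exists>B. \<forall>z. \<rho> \<le> \<bar>Im z - \<eta>\<bar> \<longrightarrow> norm (T z) \<le> B"
  proof (rule Cauchy_transform_line)
    show "continuous_on {w. Im w = \<eta>} f"
      using contf by (rule continuous_on_subset) (use strip \<eta> in auto)
    show "norm (f w) \<le> C * exp (- \<bar>Re w\<bar>)" if "Im w = \<eta>" for w
      using decay that \<eta> by simp
  qed (rule that)
  obtain L where L: "L holomorphic_on {z. Im z \<noteq> - \<eta>}"
    "\<And>z. Im z \<noteq> - \<eta> \<Longrightarrow> (\<lambda>n. contour_integral (linepath (Complex (- real n) (- \<eta>)) (Complex (real n) (- \<eta>)))
        (\<lambda>w. f w / (w - z))) \<longlonglongrightarrow> L z"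
    "\<And>\<rho>. \<rho> > 0 \<Longrightarrow> \<exists>B. \<forall>z. \<rho> \<le> \<bar>Im z - - \<eta>\<bar> \<longrightarrow> norm (L z) \<le> B"
  proof (rule Cauchy_transform_line)
    show "continuous_on {w. Im w = - \<eta>} f"
      using contf by (rule continuous_on_subset) (use strip \<eta> in auto)
    show "norm (f w) \<le> C * exp (- \<bar>Re w\<bar>)" if "Im w = - \<eta>" for w
      using decay that \<eta> by simp
  qed (rule that)
  define P where "P = (\<lambda>z. - T z / (2 * pi * \<i>))"
  define Q where "Q = (\<lambda>z. L z / (2 * pi * \<i>))"
  have PQ: "f z = P z + Q z" if "\<bar>Im z\<bar> < \<eta>" for z
  proof -
    have "L z - T z = 2 * pi * \<i> * f z"
      by (rule Cauchy_formula_strip[OF \<eta> S strip f decay that L(2) T(2)]) (use that in auto)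
    then show ?thesis by (simp add: P_def Q_def field_simps)
  qed
  have P: "P holomorphic_on {z. Im z < \<eta>}" and Q: "Q holomorphic_on {z. Im z > - \<eta>}"
    unfolding P_def Q_def
    by (auto intro!: holomorphic_intros holomorphic_on_subset[OF T(1)] holomorphic_on_subset[OF L(1)])
  \<comment> \<open>A transform is bounded only at a positive distance from its line. So
    \<open>p\<close> is estimated as \<open>P\<close> up to height \<eta>/2 and as f - Q above it;
    \<open>q\<close> is treated symmetrically.\<close>
  obtain B1 where B1: "\<And>z. \<eta> / 2 \<le> \<bar>Im z - \<eta>\<bar> \<Longrightarrow> norm (T z) \<le> B1"
    using T(3)[of "\<eta> / 2"] \<eta> by auto
  obtain B2 where B2: "\<And>z. \<eta> / 2 \<le> \<bar>Im z + \<eta>\<bar> \<Longrightarrow> norm (L z) \<le> B2"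
    using L(3)[of "\<eta> / 2"] \<eta> by auto
  obtain B where B: "\<And>z. z \<in> S \<Longrightarrow> norm (f z) \<le> B"
    using bdd by (auto simp: bounded_iff)
  have nP: "norm (P z) \<le> B1 / (2 * pi)" if "Im z \<le> \<eta> / 2" for z
  proof -
    have "norm (T z) \<le> B1" using that by (intro B1) linarith
    then show ?thesis by (simp add: P_def norm_divide norm_mult divide_right_mono)
  qed
  have nQ: "norm (Q z) \<le> B2 / (2 * pi)" if "Im z \<ge> - \<eta> / 2" for z
  proof -
    have "norm (L z) \<le> B2" using that by (intro B2) linarith
    then show ?thesis by (simp add: Q_def norm_divide norm_mult divide_right_mono)
  qed
  define p where "p = (\<lambda>z. if Im z < \<eta> then P z else f z - Q z)"
  define q where "q = (\<lambda>z. if Im z > - \<eta> then Q z else f z - P z)"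
  have o: "open {z. Im z < c}" "open {z. Im z > c}" for c
    by (intro open_Collect_less continuous_intros)+
  have "p holomorphic_on {z. Im z < \<eta>} \<union> (S \<inter> {z. Im z > - \<eta>})"
  proof (rule holomorphic_on_Un)
    show "p holomorphic_on {z. Im z < \<eta>}"
      using P by (rule holomorphic_transform) (simp add: p_def)
    have "(\<lambda>z. f z - Q z) holomorphic_on S \<inter> {z. Im z > - \<eta>}"
      by (intro holomorphic_intros holomorphic_on_subset[OF f] holomorphic_on_subset[OF Q]) auto
    then show "p holomorphic_on S \<inter> {z. Im z > - \<eta>}"
      by (rule holomorphic_transform) (use PQ in \<open>auto simp: p_def\<close>)
  qed (use S o in auto)
  then have hp: "p holomorphic_on S \<union> {z. Im z < 0}"
    by (rule holomorphic_on_subset) (use \<eta> in auto)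
  have "q holomorphic_on {z. Im z > - \<eta>} \<union> (S \<inter> {z. Im z < \<eta>})"
  proof (rule holomorphic_on_Un)
    show "q holomorphic_on {z. Im z > - \<eta>}"
      using Q by (rule holomorphic_transform) (simp add: q_def)
    have "(\<lambda>z. f z - P z) holomorphic_on S \<inter> {z. Im z < \<eta>}"
      by (intro holomorphic_intros holomorphic_on_subset[OF f] holomorphic_on_subset[OF P]) auto
    then show "q holomorphic_on S \<inter> {z. Im z < \<eta>}"
      by (rule holomorphic_transform) (use PQ in \<open>auto simp: q_def\<close>)
  qed (use S o in auto)
  then have hq: "q holomorphic_on S \<union> {z. Im z > 0}"
    by (rule holomorphic_on_subset) (use \<eta> in auto)
  have "norm (p z) \<le> max (B1 / (2 * pi)) (B + B2 / (2 * pi))" if "z \<in> S \<union> {z. Im z < 0}" for z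
  proof (cases "Im z \<le> \<eta> / 2")
    case True
    then show ?thesis using nP \<eta> by (auto simp: p_def le_max_iff_disj)
  next
    case False
    then have "z \<in> S" "p z = f z - Q z"
      using that \<eta> PQ[of z] by (auto simp: p_def)
    then have "norm (p z) \<le> B + B2 / (2 * pi)"
      using B nQ[of z] False \<eta> norm_triangle_ineq4[of "f z" "Q z"] by (smt (verit) divide_minus_left half_gt_zero)
    then show ?thesis by simp
  qed
  then have bp: "bounded (p ` (S \<union> {z. Im z < 0}))" by (auto simp: bounded_iff)
  have "norm (q z) \<le> max (B2 / (2 * pi)) (B + B1 / (2 * pi))" if "z \<in> S \<union> {z. Im z > 0}" for z
  proof (cases "Im z \<ge> - \<eta> / 2")
    case True
    then show ?thesis using nQ \<eta> by (auto simp: q_def le_max_iff_disj)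
  next
    case False
    then have "z \<in> S" "q z = f z - P z"
      using that \<eta> PQ[of z] by (auto simp: q_def)
    then have "norm (q z) \<le> B + B1 / (2 * pi)"
      using B nP[of z] False \<eta> norm_triangle_ineq4[of "f z" "P z"] by (smt (verit) divide_minus_left half_gt_zero)
    then show ?thesis by simp
  qed
  then have bq: "bounded (q ` (S \<union> {z. Im z > 0}))" by (auto simp: bounded_iff)
  have "f z = p z + q z" if "z \<in> S" for z
    using PQ[of z] \<eta> by (auto simp: p_def q_def)
  then show ?thesis using that hp hq bp bq by blast
qed

subsection \<open>Bounded approximation on generalized strips\<close>

lemma strip_functionsE:
  assumes "F \<in> strip_functions"
  obtains m S where "uniformly_continuous_on UNIV F" "0 < m" "\<And>t. m \<le> F t" "\<And>t. F t \<le> S"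
proof -
  have F: "uniformly_continuous_on UNIV F" "\<And>t. 0 < F t" "0 < (INF t. F t)" "bdd_above (range F)"
    using assms by (auto simp: strip_functions_def)
  have "bdd_below (range F)"
    by (rule bdd_belowI[of _ 0]) (use F(2) in \<open>auto intro: less_imp_le\<close>)
  then have "(INF t. F t) \<le> F t" for t by (rule cINF_lower) auto
  moreover have "F t \<le> (SUP t. F t)" for t by (rule cSUP_upper) (use F in auto)
  ultimately show ?thesis using that F by blast
qed

lemma uniformly_continuous_on_reflect:
  fixes G :: "real \<Rightarrow> real"
  assumes "uniformly_continuous_on UNIV G"
  shows "uniformly_continuous_on UNIV (\<lambda>t. G (- t))"
  using assms unfolding uniformly_continuous_on_def by (metis UNIV_I dist_minus)

lemma open_gen_strip:
  assumes "continuous_on UNIV F" "continuous_on UNIV G"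
  shows "open (gen_strip F G)"
proof -
  have "continuous_on UNIV (\<lambda>z. F (Re z))" "continuous_on UNIV (\<lambda>z. G (Re z))"
    using assms[THEN continuous_on_compose2, of UNIV Re] by (simp_all add: continuous_on_Re)
  then show ?thesis
    unfolding gen_strip_def by (intro open_Collect_conj open_Collect_less continuous_intros)
qed

lemma closure_gen_strip_subset:
  assumes "continuous_on UNIV F" "continuous_on UNIV G"
  shows "closure (gen_strip F G) \<subseteq> {z. - G (Re z) \<le> Im z \<and> Im z \<le> F (Re z)}"
proof (rule closure_minimal)
  have "continuous_on UNIV (\<lambda>z. F (Re z))" "continuous_on UNIV (\<lambda>z. G (Re z))"
    using assms[THEN continuous_on_compose2, of UNIV Re] by (simp_all add: continuous_on_Re)
  then show "closed {z. - G (Re z) \<le> Im z \<and> Im z \<le> F (Re z)}"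
    by (intro closed_Collect_conj closed_Collect_le continuous_intros)
qed (auto simp: gen_strip_def)

text \<open>The two summands of \<open>f\<close> live on one-sided domains, each with a single
  boundary curve, where vertical pushing applies. The lower curve is handled by the reflection of z
  to -z.\<close>

lemma strip_bounded_approx:
  assumes F: "uniformly_continuous_on UNIV F" and G: "uniformly_continuous_on UNIV G"
    and m: "0 < m" "\<And>t. m \<le> F t" "\<And>t. m \<le> G t" and a: "1 < a"
    and f: "f holomorphic_on gen_strip (\<lambda>t. a * F t) (\<lambda>t. a * G t)"
    and bdd: "bounded (f ` gen_strip (\<lambda>t. a * F t) (\<lambda>t. a * G t))"
    and decay: "\<And>z. z \<in> gen_strip (\<lambda>t. a * F t) (\<lambda>t. a * G t) \<Longrightarrow> norm (f z) \<le> C * exp (- \<bar>Re z\<bar>)"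
    and e: "e > 0"
  obtains h where "h holomorphic_on gen_strip (\<lambda>t. F t + s) (\<lambda>t. G t + s)"
    "bounded (h ` gen_strip (\<lambda>t. F t + s) (\<lambda>t. G t + s))"
    "\<And>z. - G (Re z) \<le> Im z \<Longrightarrow> Im z \<le> F (Re z) \<Longrightarrow> norm (f z - h z) \<le> e"
proof -
  define Y where "Y = gen_strip (\<lambda>t. a * F t) (\<lambda>t. a * G t)"
  \<comment> \<open>As \<open>F\<close> and \<open>G\<close> are at least \<open>m\<close>, scaling
    by \<open>a\<close> raises them by at least this amount everywhere.\<close>
  define d where "d = (a - 1) * m"
  define G' where "G' = (\<lambda>t. G (- t))"
  have d: "d > 0" using a m by (simp add: d_def)
  have G': "uniformly_continuous_on UNIV G'"
    unfolding G'_def using G by (rule uniformly_continuous_on_reflect)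
  have aF: "F t + d \<le> a * F t" "m \<le> a * F t" for t
  proof -
    show "F t + d \<le> a * F t"
      using mult_left_mono[OF m(2)[of t], of "a - 1"] a by (simp add: d_def algebra_simps)
    then show "m \<le> a * F t" using m(2)[of t] d by linarith
  qed
  have aG: "G t + d \<le> a * G t" "m \<le> a * G t" for t
  proof -
    show "G t + d \<le> a * G t"
      using mult_left_mono[OF m(3)[of t], of "a - 1"] a by (simp add: d_def algebra_simps)
    then show "m \<le> a * G t" using m(3)[of t] d by linarith
  qed
  have Y: "z \<in> Y" if "\<bar>Im z\<bar> \<le> m / 2" for z
    using that aF(2)[of "Re z"] aG(2)[of "Re z"] m(1) by (auto simp: Y_def gen_strip_def)
  have oY: "open Y"
    unfolding Y_def using F G
    by (intro open_gen_strip continuous_intros uniformly_continuous_imp_continuous)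
  obtain p q where p: "p holomorphic_on Y \<union> {z. Im z < 0}" "bounded (p ` (Y \<union> {z. Im z < 0}))"
    and q: "q holomorphic_on Y \<union> {z. Im z > 0}" "bounded (q ` (Y \<union> {z. Im z > 0}))"
    and pq: "\<And>z. z \<in> Y \<Longrightarrow> f z = p z + q z"
  proof (rule holomorphic_split_real_line[of "m / 2" Y f C])
    show "norm (f z) \<le> C * exp (- \<bar>Re z\<bar>)" if "\<bar>Im z\<bar> \<le> m / 2" for z
      using decay Y[OF that] by (simp add: Y_def)
  qed (use m oY Y f bdd in \<open>auto simp: Y_def\<close>)
  \<comment> \<open>A point of the subgraph that is not in \<open>Y\<close> lies on or below the
    lower boundary of \<open>Y\<close>, hence below the real line.\<close>
  have subF: "subgraph F d \<subseteq> Y \<union> {z. Im z < 0}"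
  proof
    fix z assume "z \<in> subgraph F d"
    then show "z \<in> Y \<union> {z. Im z < 0}"
      using aF(1)[of "Re z"] aG(2)[of "Re z"] m(1) by (auto simp: subgraph_def Y_def gen_strip_def)
  qed
  have subG: "uminus ` subgraph G' d \<subseteq> Y \<union> {z. Im z > 0}"
  proof
    fix z assume "z \<in> uminus ` subgraph G' d"
    then show "z \<in> Y \<union> {z. Im z > 0}"
      using aG(1)[of "Re z"] aF(2)[of "Re z"] m(1)
      by (auto simp: subgraph_def Y_def gen_strip_def G'_def)
  qed
  have "p \<in> bdd_hol F d"
    using p subF subgraph_mono[of _ d F]
    by (auto simp: bdd_hol_def intro: holomorphic_on_subset bounded_subset[OF _ image_mono] dest!: less_imp_le)
  \<comment> \<open>Level s + 1 ensures boundedness at level \<open>s\<close>. The positive level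
    d/2 includes the boundary curve, as the estimate is wanted on the closed strip.\<close>
  then obtain P where P: "P \<in> bdd_hol F (s + 1)" "\<And>z. z \<in> subgraph F (d / 2) \<Longrightarrow> norm (p z - P z) \<le> e / 2"
    using bdd_hol_approx[OF F, of "d / 2" d p "e / 2" "s + 1"] d e by auto
  have "(q \<circ> uminus) holomorphic_on subgraph G' d"
    by (rule holomorphic_on_compose_gen[OF _ q(1) subG]) (intro holomorphic_intros)
  moreover have "bounded ((q \<circ> uminus) ` subgraph G' t)" if "t < d" for t
    using subG subgraph_mono[of t d G'] that
    unfolding image_comp[symmetric] by (intro bounded_subset[OF q(2)] image_mono) auto
  ultimately have "q \<circ> uminus \<in> bdd_hol G' d" by (simp add: bdd_hol_def)
  then obtain Q where Q: "Q \<in> bdd_hol G' (s + 1)"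
      "\<And>z. z \<in> subgraph G' (d / 2) \<Longrightarrow> norm ((q \<circ> uminus) z - Q z) \<le> e / 2"
    using bdd_hol_approx[OF G', of "d / 2" d "q \<circ> uminus" "e / 2" "s + 1"] d e by auto
  let ?X = "gen_strip (\<lambda>t. F t + s) (\<lambda>t. G t + s)"
  have X: "?X \<subseteq> subgraph F s" "uminus ` ?X \<subseteq> subgraph G' s"
    by (auto simp: gen_strip_def subgraph_def G'_def)
  show ?thesis
  proof (rule that[of "\<lambda>z. P z + (Q \<circ> uminus) z"])
    have "(Q \<circ> uminus) holomorphic_on ?X"
    proof (rule holomorphic_on_compose_gen)
      show "Q holomorphic_on subgraph G' (s + 1)" using Q by (simp add: bdd_hol_def)
      show "uminus ` ?X \<subseteq> subgraph G' (s + 1)"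
        using X(2) subgraph_mono[of s "s + 1" G'] by auto
    qed (intro holomorphic_intros)
    moreover have "P holomorphic_on ?X"
      using P(1) X(1) subgraph_mono[of s "s + 1" F]
      by (auto simp: bdd_hol_def intro: holomorphic_on_subset)
    ultimately show "(\<lambda>z. P z + (Q \<circ> uminus) z) holomorphic_on ?X"
      by (intro holomorphic_intros)
    have "bounded (P ` ?X)"
      by (rule bounded_subset[OF _ image_mono[OF X(1)]]) (use P(1) in \<open>simp add: bdd_hol_def\<close>)
    moreover have "bounded ((Q \<circ> uminus) ` ?X)"
      unfolding image_comp[symmetric]
      by (rule bounded_subset[OF _ image_mono[OF X(2)]]) (use Q(1) in \<open>simp add: bdd_hol_def\<close>)
    ultimately show "bounded ((\<lambda>z. P z + (Q \<circ> uminus) z) ` ?X)"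
      by (rule bounded_plus_comp)
    fix z assume z: "- G (Re z) \<le> Im z" "Im z \<le> F (Re z)"
    then have "z \<in> Y"
      using aF(1)[of "Re z"] aG(1)[of "Re z"] d by (auto simp: Y_def gen_strip_def)
    moreover have "z \<in> subgraph F (d / 2)" "- z \<in> subgraph G' (d / 2)"
      using z d by (auto simp: subgraph_def G'_def)
    then have "norm (p z - P z) \<le> e / 2" "norm (q z - (Q \<circ> uminus) z) \<le> e / 2"
      using P(2)[of z] Q(2)[of "- z"] by auto
    ultimately show "norm (f z - (P z + (Q \<circ> uminus) z)) \<le> e"
      using norm_triangle_ineq[of "p z - P z" "q z - (Q \<circ> uminus) z"] pq[of z]
      by (simp add: algebra_simps)
  qed
qed

subsection \<open>The damping factor\<close>

text \<open>This is \<open>exp (- \<delta> * cosh (\<mu> * z))\<close>; the cosine form gives access to \<open>Re_cos\<close>.\<close>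

definition damp :: "real \<Rightarrow> real \<Rightarrow> complex \<Rightarrow> complex" where
  "damp \<delta> \<mu> z = exp (- (of_real \<delta> * cos (\<i> * of_real \<mu> * z)))"

lemma damp_holomorphic [holomorphic_intros]: "damp \<delta> \<mu> holomorphic_on A"
  unfolding damp_def by (intro holomorphic_intros)

lemma damp_double: "damp (2 * \<delta>) \<mu> z = damp \<delta> \<mu> z * damp \<delta> \<mu> z"
  by (simp add: damp_def mult.assoc flip: exp_add)

text \<open>The real part is cosh(\<mu> x) cos(\<mu> y) for z = x + \<i> y, and cos(\<mu> y) is at
  least 1/2 because 1 < pi/3.\<close>

lemma Re_cos_ge:
  assumes \<mu>: "\<mu> \<ge> 0" and z: "\<bar>\<mu> * Im z\<bar> \<le> 1"
  shows "exp (\<mu> * \<bar>Re z\<bar>) / 4 \<le> Re (cos (\<i> * of_real \<mu> * z))"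
proof -
  have "cos (pi / 3) \<le> cos \<bar>\<mu> * Im z\<bar>"
    by (rule cos_monotone_0_pi_le) (use z pi_gt3 in auto)
  then have c: "1 / 2 \<le> cos (\<mu> * Im z)" by (simp add: cos_60)
  have "exp (\<mu> * \<bar>Re z\<bar>) \<le> exp (\<mu> * Re z) + exp (- (\<mu> * Re z))"
    using \<mu> by (cases "Re z \<ge> 0") auto
  then have "(1 / 2) * exp (\<mu> * \<bar>Re z\<bar>) \<le> cos (\<mu> * Im z) * (exp (\<mu> * Re z) + exp (- (\<mu> * Re z)))"
    using c by (intro mult_mono) auto
  then show ?thesis by (simp add: Re_cos)
qed

lemma norm_damp_le:
  assumes "\<mu> \<ge> 0" "\<bar>\<mu> * Im z\<bar> \<le> 1" "\<delta> \<ge> 0"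
  shows "norm (damp \<delta> \<mu> z) \<le> exp (- (\<delta> / 4 * exp (\<mu> * \<bar>Re z\<bar>)))"
  using mult_left_mono[OF Re_cos_ge[OF assms(1,2)] assms(3)] by (simp add: damp_def)

text \<open>The derivative of exp has modulus at most 1 on the left half-plane, which is
  convex.\<close>

lemma norm_exp_minus_one_le:
  assumes "Re w \<le> 0"
  shows "norm (exp w - 1) \<le> norm w"
proof -
  have "norm (exp w - exp 0) \<le> 1 * norm (w - 0)"
  proof (rule field_differentiable_bound[of "{w. Re w \<le> 0}"])
    show "convex {w. Re w \<le> 0}" by (rule convex_halfspace_Re_le)
    show "(exp has_field_derivative exp u) (at u within {w. Re w \<le> 0})" for u :: complex
      by (intro derivative_eq_intros) auto
  qed (use assms in auto)
  then show ?thesis by simp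
qed

text \<open>Quantifies the convergence of the damping factor to 1 on bounded sets as \<delta> tends
  to 0.\<close>

lemma norm_one_minus_damp_le:
  assumes "\<mu> \<ge> 0" "\<bar>\<mu> * Im z\<bar> \<le> 1" "\<delta> \<ge> 0"
  shows "norm (1 - damp \<delta> \<mu> z) \<le> \<delta> * exp (\<mu> * norm z)"
proof -
  let ?c = "cos (\<i> * of_real \<mu> * z)"
  have "0 \<le> Re ?c" using Re_cos_ge[OF assms(1,2)] by (smt (verit) divide_nonneg_pos exp_ge_zero)
  then have "norm (damp \<delta> \<mu> z - 1) \<le> norm (of_real \<delta> * ?c)"
    using norm_exp_minus_one_le[of "- (of_real \<delta> * ?c)"] assms by (simp add: damp_def)
  also have "\<dots> \<le> \<delta> * exp (norm (\<i> * of_real \<mu> * z))"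
    unfolding norm_mult[of "of_real \<delta>"] norm_of_real abs_of_nonneg[OF assms(3)]
    by (intro mult_left_mono norm_cos_le assms)
  finally show ?thesis using assms by (simp add: norm_mult norm_minus_commute)
qed

text \<open>Completing the square in X = exp(\<mu> x / 2); growth at half the rate is beaten by the
  square of X.\<close>

lemma double_exp_dominates:
  fixes \<kappa> :: real
  assumes "\<kappa> > 0"
  shows "C * exp (\<mu> / 2 * x) - \<kappa> * exp (\<mu> * x) \<le> C\<^sup>2 / (4 * \<kappa>)"
proof -
  define X where "X = exp (\<mu> / 2 * x)"
  have X2: "exp (\<mu> * x) = X\<^sup>2" by (simp add: X_def flip: exp_double)
  have "0 \<le> (2 * \<kappa> * X - C)\<^sup>2" by simp
  then have "C * X - \<kappa> * X\<^sup>2 \<le> C\<^sup>2 / (4 * \<kappa>)"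
    using assms by (simp add: field_simps power2_eq_square)
  then show ?thesis unfolding X2 by (simp only: X_def)
qed

text \<open>Supplies the exponential decay that the Cauchy integrals over horizontal lines
  require.\<close>

lemma double_exp_decay:
  fixes \<kappa> \<mu> :: real
  assumes \<kappa>: "\<kappa> > 0" and \<mu>: "\<mu> > 0"
  obtains C where "\<And>x. x \<ge> 0 \<Longrightarrow> exp (- (\<kappa> * exp (\<mu> * x))) \<le> C * exp (- x)"
proof (rule that)
  fix x :: real
  have "x \<le> 2 / \<mu> * exp (\<mu> / 2 * x)"
    using exp_ge_add_one_self[of "\<mu> / 2 * x"] \<mu> by (simp add: field_simps)
  then have "x - \<kappa> * exp (\<mu> * x) \<le> (2 / \<mu>)\<^sup>2 / (4 * \<kappa>)"
    using double_exp_dominates[OF \<kappa>, of "2 / \<mu>" \<mu> x] by linarith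
  then have "exp (- (\<kappa> * exp (\<mu> * x))) \<le> exp ((2 / \<mu>)\<^sup>2 / (4 * \<kappa>) + - x)"
    unfolding exp_le_cancel_iff by linarith
  then show "exp (- (\<kappa> * exp (\<mu> * x))) \<le> exp ((2 / \<mu>)\<^sup>2 / (4 * \<kappa>)) * exp (- x)"
    by (simp only: exp_add)
qed

text \<open>The weight grows at most at rate \<mu>/2, so the double exponential wins. The points x
  and y may differ by 1 because Cauchy's estimate compares the weight at the centre of a disc with
  the function on its circle.\<close>

lemma weight_double_exp:
  assumes W: "weight_function_system W" "cond_epsilon0 W" and \<kappa>: "\<kappa> > 0" and \<mu>: "\<mu> > 0"
  obtains B where "B > 0"
    "\<And>x y. \<bar>x - y\<bar> \<le> 1 \<Longrightarrow> exp (W K \<bar>x\<bar>) * exp (- (\<kappa> * exp (\<mu> * \<bar>y\<bar>))) \<le> B"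
proof -
  obtain C where C: "C \<ge> 0" "\<And>t. t \<ge> 0 \<Longrightarrow> W K t \<le> C * exp (\<mu> / 2 * t)"
    using weight_exp_bound[OF W, of "\<mu> / 2"] \<mu> by auto
  show ?thesis
  proof (rule that)
    fix x y :: real assume xy: "\<bar>x - y\<bar> \<le> 1"
    have "W K \<bar>x\<bar> \<le> C * exp (\<mu> / 2 * \<bar>x\<bar>)" using C by simp
    also have "\<dots> \<le> C * exp (\<mu> / 2 * (1 + \<bar>y\<bar>))"
      using xy C \<mu> by (intro mult_left_mono) auto
    also have "\<dots> = (C * exp (\<mu> / 2)) * exp (\<mu> / 2 * \<bar>y\<bar>)"
      by (simp add: ring_distribs exp_add)
    finally have "W K \<bar>x\<bar> - \<kappa> * exp (\<mu> * \<bar>y\<bar>) \<le> (C * exp (\<mu> / 2))\<^sup>2 / (4 * \<kappa>)"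
      using double_exp_dominates[OF \<kappa>, of "C * exp (\<mu> / 2)" \<mu> "\<bar>y\<bar>"] by linarith
    then show "exp (W K \<bar>x\<bar>) * exp (- (\<kappa> * exp (\<mu> * \<bar>y\<bar>))) \<le> exp ((C * exp (\<mu> / 2))\<^sup>2 / (4 * \<kappa>))"
      by (simp flip: exp_add)
  qed simp
qed

subsection \<open>Membership in the weighted spaces\<close>

lemma U_space_bound:
  assumes f: "f \<in> U_space w F G" and c: "0 < c" "c < 1"
  obtains B where "\<And>z. z \<in> gen_strip (\<lambda>t. c * F t) (\<lambda>t. c * G t) \<Longrightarrow> exp (w \<bar>Re z\<bar>) * norm (f z) \<le> B"
proof -
  let ?S = "gen_strip (\<lambda>t. c * F t) (\<lambda>t. c * G t)"
  let ?s = "SUP \<xi>\<in>closure ?S. ereal (exp (w \<bar>Re \<xi>\<bar>) * norm (partial_deriv (0, 0) f \<xi>))"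
  have c': "c \<in> {0<..<1}" using c by simp
  have "?s < \<infinity>"
    by (rule f[unfolded U_space_def mem_Collect_eq, THEN conjunct2, THEN spec, THEN bspec, OF c'])
  then obtain B where B: "?s \<le> ereal B"
    by (cases ?s) auto
  have "exp (w \<bar>Re z\<bar>) * norm (f z) \<le> B" if "z \<in> ?S" for z
  proof -
    have "ereal (exp (w \<bar>Re z\<bar>) * norm (partial_deriv (0, 0) f z)) \<le> ?s"
      by (rule SUP_upper) (use that closure_subset in auto)
    also note B
    finally show ?thesis by (simp add: partial_deriv_def)
  qed
  then show ?thesis using that by blast
qed

text \<open>Cauchy's estimate on discs of one radius at most 1 inside the larger strip: the weight
  at the centre is a constant there, so a bound on \<open>g\<close> alone controls all derivatives.
  Enlarging by added constants gives the vertical margin \<open>s - s'\<close> that makes the radius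
  uniform.\<close>

lemma U_spaceI:
  assumes F: "uniformly_continuous_on UNIV F" and G: "uniformly_continuous_on UNIV G"
    and F': "continuous_on UNIV F'" "\<And>t. 0 \<le> F' t" "\<And>t. F' t < F t + s'"
    and G': "continuous_on UNIV G'" "\<And>t. 0 \<le> G' t" "\<And>t. G' t < G t + s'"
    and s: "s' < s"
    and g: "g holomorphic_on gen_strip (\<lambda>t. F t + s) (\<lambda>t. G t + s)"
    and bound: "\<And>x z. z \<in> gen_strip (\<lambda>t. F t + s) (\<lambda>t. G t + s) \<Longrightarrow> \<bar>x - Re z\<bar> \<le> 1
      \<Longrightarrow> exp (w \<bar>x\<bar>) * norm (g z) \<le> B"
  shows "g \<in> U_space w F' G'"
proof -
  let ?X = "gen_strip (\<lambda>t. F t + s) (\<lambda>t. G t + s)"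
  have oX: "open ?X"
    using F G by (intro open_gen_strip continuous_intros uniformly_continuous_imp_continuous)
  obtain r1 where r1: "r1 > 0" "\<And>z. z \<in> subgraph F s' \<Longrightarrow> cball z r1 \<subseteq> subgraph F s"
    using subgraph_cball[OF F, of "s - s'"] s by (metis add.commute diff_add_cancel diff_gt_0_iff_gt)
  obtain r2 where r2: "r2 > 0" "\<And>z. z \<in> subgraph (\<lambda>t. G (- t)) s' \<Longrightarrow> cball z r2 \<subseteq> subgraph (\<lambda>t. G (- t)) s"
    using subgraph_cball[OF uniformly_continuous_on_reflect[OF G], of "s - s'"] s
    by (metis add.commute diff_add_cancel diff_gt_0_iff_gt)
  define r where "r = min 1 (min r1 r2)"
  have r: "0 < r" "r \<le> 1" using r1 r2 by (auto simp: r_def)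
  have ball: "cball z r \<subseteq> ?X" if "- G' (Re z) \<le> Im z" "Im z \<le> F' (Re z)" for z
  proof
    fix w assume w: "w \<in> cball z r"
    have "z \<in> subgraph F s'" using that F'(3)[of "Re z"] by (simp add: subgraph_def)
    then have "w \<in> subgraph F s" using r1(2)[of z] w by (auto simp: r_def)
    have "- z \<in> subgraph (\<lambda>t. G (- t)) s'" using that G'(3)[of "Re z"] by (simp add: subgraph_def)
    moreover have "- w \<in> cball (- z) r2" using w by (simp add: r_def dist_minus)
    ultimately have "- w \<in> subgraph (\<lambda>t. G (- t)) s" using r2(2) by blast
    with \<open>w \<in> subgraph F s\<close> show "w \<in> ?X" by (auto simp: subgraph_def gen_strip_def)
  qed
  have sub: "gen_strip F' G' \<subseteq> ?X"
  proof
    fix z assume "z \<in> gen_strip F' G'"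
    then have "- G' (Re z) \<le> Im z" "Im z \<le> F' (Re z)" by (auto simp: gen_strip_def)
    from ball[OF this] show "z \<in> ?X" using r(1) by (meson centre_in_cball less_imp_le subsetD)
  qed
  have est: "exp (w \<bar>Re \<xi>\<bar>) * norm (partial_deriv \<alpha> g \<xi>) \<le> fact (fst \<alpha> + snd \<alpha>) * B / r ^ (fst \<alpha> + snd \<alpha>)"
    if \<xi>: "- G' (Re \<xi>) \<le> Im \<xi>" "Im \<xi> \<le> F' (Re \<xi>)" for \<alpha> \<xi>
  proof -
    let ?k = "fst \<alpha> + snd \<alpha>" and ?E = "exp (w \<bar>Re \<xi>\<bar>)"
    have hol: "g holomorphic_on cball \<xi> r" using g ball[OF \<xi>] by (rule holomorphic_on_subset)
    have "norm ((deriv ^^ ?k) g \<xi>) \<le> fact ?k * (B / ?E) / r ^ ?k"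
    proof (rule Cauchy_inequality)
      show "g holomorphic_on ball \<xi> r" using hol by (rule holomorphic_on_subset) auto
      show "continuous_on (cball \<xi> r) g" using hol by (rule holomorphic_on_imp_continuous_on)
      fix x assume x: "norm (\<xi> - x) = r"
      then have "x \<in> ?X" using ball[OF \<xi>] by (auto simp: subset_iff dist_norm)
      moreover have "\<bar>Re \<xi> - Re x\<bar> \<le> 1"
        using abs_Re_le_cmod[of "\<xi> - x"] x r by simp
      ultimately show "norm (g x) \<le> B / ?E"
        using bound[of x "Re \<xi>"] by (simp add: field_simps)
    qed (use r in auto)
    then have "?E * norm ((deriv ^^ ?k) g \<xi>) \<le> ?E * (fact ?k * (B / ?E) / r ^ ?k)"
      by (intro mult_left_mono) auto
    moreover have "\<xi> \<in> ?X" using ball[OF \<xi>] r by auto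
    ultimately show ?thesis using norm_partial_deriv[OF oX _ g] by simp
  qed
  have "(SUP \<xi>\<in>closure (gen_strip (\<lambda>t. c * F' t) (\<lambda>t. c * G' t)).
      ereal (exp (w \<bar>Re \<xi>\<bar>) * norm (partial_deriv \<alpha> g \<xi>))) < \<infinity>" if c: "c \<in> {0<..<1}" for \<alpha> c
  proof -
    have "(SUP \<xi>\<in>closure (gen_strip (\<lambda>t. c * F' t) (\<lambda>t. c * G' t)).
      ereal (exp (w \<bar>Re \<xi>\<bar>) * norm (partial_deriv \<alpha> g \<xi>)))
      \<le> ereal (fact (fst \<alpha> + snd \<alpha>) * B / r ^ (fst \<alpha> + snd \<alpha>))"
    proof (rule SUP_least)
      fix \<xi> assume "\<xi> \<in> closure (gen_strip (\<lambda>t. c * F' t) (\<lambda>t. c * G' t))"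
      then have "- (c * G' (Re \<xi>)) \<le> Im \<xi>" "Im \<xi> \<le> c * F' (Re \<xi>)"
        using closure_gen_strip_subset[OF continuous_on_mult_left[OF F'(1), of c] continuous_on_mult_left[OF G'(1), of c]]
        by auto
      moreover have "c * F' (Re \<xi>) \<le> F' (Re \<xi>)" "c * G' (Re \<xi>) \<le> G' (Re \<xi>)"
        using c F'(2) G'(2) by (auto intro!: mult_left_le_one_le)
      ultimately show "ereal (exp (w \<bar>Re \<xi>\<bar>) * norm (partial_deriv \<alpha> g \<xi>))
        \<le> ereal (fact (fst \<alpha> + snd \<alpha>) * B / r ^ (fst \<alpha> + snd \<alpha>))"
        using est[of \<xi> \<alpha>] by simp
    qed
    then show ?thesis using order_le_less_trans by fastforce
  qed
  then show ?thesis
    using holomorphic_on_subset[OF g sub] by (simp add: U_space_def)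
qed

section \<open>Approximation in the weighted norm\<close>

lemma strip_weighted_approx:
  assumes F: "F \<in> strip_functions" and G: "G \<in> strip_functions"
    and W: "weight_function_system W" "cond_epsilon0 W"
    and MN: "C \<ge> 0" "\<And>u. u > 0 \<Longrightarrow> exp (W N u - W M u) \<le> C / u" "N \<le> M"
    and ab: "1 < a" "a < b" and \<epsilon>: "0 < \<epsilon>"
    and f: "f \<in> U_space (W M) (\<lambda>t. a * F t) (\<lambda>t. a * G t)"
  shows "\<exists>g\<in>U_space (W K) (\<lambda>t. b * F t) (\<lambda>t. b * G t).
    \<forall>z. - G (Re z) \<le> Im z \<and> Im z \<le> F (Re z) \<longrightarrow> exp (W N \<bar>Re z\<bar>) * norm (f z - g z) \<le> \<epsilon>"
proof -
  obtain m1 S1 where F: "uniformly_continuous_on UNIV F" "0 < m1" "\<And>t. m1 \<le> F t" "\<And>t. F t \<le> S1"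
    using F by (rule strip_functionsE) (rule that)
  obtain m2 S2 where G: "uniformly_continuous_on UNIV G" "0 < m2" "\<And>t. m2 \<le> G t" "\<And>t. G t \<le> S2"
    using G by (rule strip_functionsE) (rule that)
  define m where "m = min m1 m2"
  define S where "S = max S1 S2"
  have m: "0 < m" "\<And>t. m \<le> F t" "\<And>t. m \<le> G t" and S: "\<And>t. F t \<le> S" "\<And>t. G t \<le> S"
    using F G by (auto simp: m_def S_def min_le_iff_disj le_max_iff_disj)
  have S0: "0 < S" using m(1) m(2)[of 0] S(1)[of 0] by linarith
  have pos: "0 < F t" "0 < G t" for t
    using m(1) m(2)[of t] m(3)[of t] by linarith+
  have w: "weight_function (W n)" for n
    using W by (simp add: weight_function_system_def)
  have wNM: "W N \<bar>x\<bar> \<le> W M \<bar>x\<bar>" for x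
    using W(1) MN(3) by (simp add: weight_function_system_def)

  \<comment> \<open>The bounds on \<open>f\<close> hold only on strictly smaller strips, so
    \<open>a\<close> is lowered to a value still above 1.\<close>
  define a' where "a' = (a + 1) / 2"
  define c where "c = a' / a"
  have a': "1 < a'" "a' < a" using ab by (auto simp: a'_def)
  have c: "0 < c" "c < 1" using a' ab by (auto simp: c_def)
  have ca: "c * (a * x) = a' * x" for x using ab by (simp add: c_def)
  define Y where "Y = gen_strip (\<lambda>t. a' * F t) (\<lambda>t. a' * G t)"
  obtain B0 where B0: "\<And>z. z \<in> Y \<Longrightarrow> exp (W M \<bar>Re z\<bar>) * norm (f z) \<le> B0"
    using U_space_bound[OF f c] unfolding ca Y_def by blast
  define B where "B = max B0 1"
  have B: "B > 0" "\<And>z. z \<in> Y \<Longrightarrow> exp (W M \<bar>Re z\<bar>) * norm (f z) \<le> B"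
    using B0 by (auto simp: B_def le_max_iff_disj)
  have fB: "norm (f z) \<le> B" if "z \<in> Y" for z
  proof -
    have "1 * norm (f z) \<le> exp (W M \<bar>Re z\<bar>) * norm (f z)"
      using weight_function_nonneg[OF w] by (intro mult_right_mono) auto
    then show ?thesis using B(2)[OF that] by linarith
  qed
  have mulF: "u * F t \<le> v * F t" "u * G t \<le> v * G t" if "u \<le> v" for u v t
    using that pos[of t] by (auto intro: mult_right_mono)
  have ZY: "z \<in> Y" if "- G (Re z) \<le> Im z" "Im z \<le> F (Re z)" for z
  proof -
    have "1 * F (Re z) < a' * F (Re z)" "1 * G (Re z) < a' * G (Re z)"
      using a'(1) pos by (auto intro!: mult_strict_right_mono simp del: mult_1)
    then show ?thesis using that by (simp add: Y_def gen_strip_def)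
  qed
  have holf: "f holomorphic_on Y"
  proof (rule holomorphic_on_subset)
    show "f holomorphic_on gen_strip (\<lambda>t. a * F t) (\<lambda>t. a * G t)" using f by (simp add: U_space_def)
    show "Y \<subseteq> gen_strip (\<lambda>t. a * F t) (\<lambda>t. a * G t)"
      using mulF[of a' a] a' unfolding Y_def gen_strip_def by (smt (verit) Collect_mono)
  qed

  \<comment> \<open>Since \<open>F\<close> and \<open>G\<close> are at most \<open>S\<close>,
    raising them by \<open>s\<close> exceeds scaling by \<open>b\<close>, with 1 to spare for the
    discs in \<open>U_spaceI\<close>.\<close>
  define s where "s = (b - 1) * S + 1"
  define X where "X = gen_strip (\<lambda>t. F t + s) (\<lambda>t. G t + s)"
  \<comment> \<open>\<open>H\<close> bounds the imaginary parts on both \<open>Y\<close> and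
    \<open>X\<close>; with its reciprocal as \<mu> the damping estimates hold on both.\<close>
  define H where "H = (a + b) * S + 1"
  define \<mu> where "\<mu> = 1 / H"
  have H: "H > 0" using ab S0 by (simp add: H_def add_pos_pos)
  have \<mu>: "\<mu> > 0" using H by (simp add: \<mu>_def)
  have smallI: "\<bar>\<mu> * Im z\<bar> \<le> 1" if "\<bar>Im z\<bar> \<le> H" for z
    using that H by (simp add: \<mu>_def abs_mult)
  have YH: "\<bar>Im z\<bar> \<le> H" if "z \<in> Y" for z
  proof -
    have "a' * F t \<le> a * S" "a' * G t \<le> a * S" for t
      using mult_mono[of a' a "F t" S] mult_mono[of a' a "G t" S] a' ab S[of t] pos[of t] by auto
    moreover have "a * S \<le> H" using ab S0 by (simp add: H_def algebra_simps)
    ultimately show ?thesis using that unfolding Y_def gen_strip_def by (smt (verit) mem_Collect_eq)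
  qed
  have XH: "\<bar>Im z\<bar> \<le> H" if "z \<in> X" for z
  proof -
    have "F t + s \<le> H" "G t + s \<le> H" for t
    proof -
      have "S + s \<le> H" using ab S0 by (simp add: s_def H_def algebra_simps)
      then show "F t + s \<le> H" "G t + s \<le> H" using S[of t] by linarith+
    qed
    then show ?thesis using that unfolding X_def gen_strip_def by (smt (verit) mem_Collect_eq)
  qed
  have ZX: "z \<in> X" if "- G (Re z) \<le> Im z" "Im z \<le> F (Re z)" for z
  proof -
    have "s > 0" using ab S0 by (simp add: s_def add_pos_pos)
    then show ?thesis using that by (simp add: X_def gen_strip_def)
  qed

  \<comment> \<open>Beyond \<open>R\<close> the gap between the weights makes \<open>f\<close> at
    most \<epsilon>/4 in the \<open>W N\<close> norm. Up to \<open>R\<close> the choice of \<delta>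
    below makes the damping factor close enough to 1.\<close>
  define R where "R = 4 * B * C / \<epsilon> + 1"
  have R: "R > 0" using B(1) MN(1) \<epsilon> by (simp add: R_def add_nonneg_pos)
  define \<delta> where "\<delta> = \<epsilon> / (4 * B * exp (\<mu> * (R + H)))"
  have \<delta>: "\<delta> > 0" using \<epsilon> B by (simp add: \<delta>_def)
  have part1: "exp (W N \<bar>Re z\<bar>) * norm (f z - f z * damp (2 * \<delta>) \<mu> z) \<le> \<epsilon> / 2" if z: "z \<in> Y" for z
  proof -
    have n: "norm (f z - f z * damp (2 * \<delta>) \<mu> z) = norm (f z) * norm (1 - damp (2 * \<delta>) \<mu> z)"
      by (simp add: algebra_simps flip: norm_mult)
    show ?thesis
    proof (cases "\<bar>Re z\<bar> \<le> R")
      case True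
      have "norm z \<le> R + H"
        using cmod_le[of z] True YH[OF z] by linarith
      then have "norm (1 - damp (2 * \<delta>) \<mu> z) \<le> (2 * \<delta>) * exp (\<mu> * (R + H))"
        using norm_one_minus_damp_le[of \<mu> z "2 * \<delta>"] smallI[OF YH[OF z]] \<mu> \<delta>
        by (smt (verit) exp_le_cancel_iff mult_left_mono)
      moreover have "exp (W N \<bar>Re z\<bar>) * norm (f z) \<le> B"
        using B(2)[OF z] wNM[of "Re z"] mult_right_mono[of "exp (W N \<bar>Re z\<bar>)" "exp (W M \<bar>Re z\<bar>)" "norm (f z)"] by simp
      ultimately have "(exp (W N \<bar>Re z\<bar>) * norm (f z)) * norm (1 - damp (2 * \<delta>) \<mu> z)
          \<le> B * ((2 * \<delta>) * exp (\<mu> * (R + H)))"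
        using B(1) by (intro mult_mono) auto
      also have "\<dots> = \<epsilon> / 2" using B(1) by (simp add: \<delta>_def)
      finally show ?thesis by (simp add: n mult.assoc)
    next
      case False
      then have x: "\<bar>Re z\<bar> > 0" using R by linarith
      have "exp (W N \<bar>Re z\<bar>) * norm (f z) = exp (W N \<bar>Re z\<bar> - W M \<bar>Re z\<bar>) * (exp (W M \<bar>Re z\<bar>) * norm (f z))"
        by (simp add: exp_diff)
      also have "\<dots> \<le> C / \<bar>Re z\<bar> * B"
        using MN(2)[OF x] B(2)[OF z] MN(1) by (intro mult_mono) auto
      also have "\<dots> \<le> C / R * B"
        using False R MN(1) B(1) by (intro mult_right_mono divide_left_mono) auto
      also have "\<dots> \<le> \<epsilon> / 4"
        using R \<epsilon> by (simp add: field_simps R_def)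
      finally have 1: "exp (W N \<bar>Re z\<bar>) * norm (f z) \<le> \<epsilon> / 4" .
      have "norm (damp (2 * \<delta>) \<mu> z) \<le> exp (- ((2 * \<delta>) / 4 * exp (\<mu> * \<bar>Re z\<bar>)))"
        using norm_damp_le[of \<mu> z "2 * \<delta>"] smallI[OF YH[OF z]] \<mu> \<delta> by simp
      also have "\<dots> \<le> 1" using \<delta> by simp
      finally have "norm (1 - damp (2 * \<delta>) \<mu> z) \<le> 2"
        using norm_triangle_ineq4[of 1 "damp (2 * \<delta>) \<mu> z"] by simp
      then have "(exp (W N \<bar>Re z\<bar>) * norm (f z)) * norm (1 - damp (2 * \<delta>) \<mu> z) \<le> \<epsilon> / 4 * 2"
        using 1 \<epsilon> by (intro mult_mono) auto
      then show ?thesis by (simp add: n mult.assoc)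
    qed
  qed

  define \<kappa> where "\<kappa> = \<delta> / 4"
  have \<kappa>: "\<kappa> > 0" using \<delta> by (simp add: \<kappa>_def)
  have damp: "norm (damp \<delta> \<mu> z) \<le> exp (- (\<kappa> * exp (\<mu> * \<bar>Re z\<bar>)))" if "\<bar>Im z\<bar> \<le> H" for z
    using norm_damp_le[of \<mu> z \<delta>] smallI[OF that] \<mu> \<delta> by (simp add: \<kappa>_def)
  obtain D where D: "\<And>x. x \<ge> 0 \<Longrightarrow> exp (- (\<kappa> * exp (\<mu> * x))) \<le> D * exp (- x)"
    using double_exp_decay[OF \<kappa> \<mu>] by blast
  obtain BN where BN: "BN > 0"
    "\<And>x y. \<bar>x - y\<bar> \<le> 1 \<Longrightarrow> exp (W N \<bar>x\<bar>) * exp (- (\<kappa> * exp (\<mu> * \<bar>y\<bar>))) \<le> BN"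
    using weight_double_exp[OF W \<kappa> \<mu>] by blast
  \<comment> \<open>Only this constant depends on \<open>K\<close>: the damping outruns every
    weight, so the same \<delta> serves all \<open>K\<close>.\<close>
  obtain BK where BK: "BK > 0"
    "\<And>x y. \<bar>x - y\<bar> \<le> 1 \<Longrightarrow> exp (W K \<bar>x\<bar>) * exp (- (\<kappa> * exp (\<mu> * \<bar>y\<bar>))) \<le> BK"
    using weight_double_exp[OF W \<kappa> \<mu>] by blast
  \<comment> \<open>One damping factor gives \<open>f1\<close> its decay; the second is kept to
    multiply the approximant.\<close>
  define f1 where "f1 = (\<lambda>z. f z * damp \<delta> \<mu> z)"
  have f1: "norm (f1 z) \<le> B * exp (- (\<kappa> * exp (\<mu> * \<bar>Re z\<bar>)))" if "z \<in> Y" for z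
    unfolding f1_def norm_mult using fB[OF that] damp[OF YH[OF that]] B(1) by (intro mult_mono) auto
  \<comment> \<open>The remaining damping factor times the weight \<open>W N\<close> is at most
    \<open>BN\<close>, so this tolerance costs \<epsilon>/2 in the weighted norm.\<close>
  obtain h where h: "h holomorphic_on X" "bounded (h ` X)"
    "\<And>z. - G (Re z) \<le> Im z \<Longrightarrow> Im z \<le> F (Re z) \<Longrightarrow> norm (f1 z - h z) \<le> \<epsilon> / (2 * BN)"
  proof (rule strip_bounded_approx[OF F(1) G(1) m a'(1), of f1 "B * D" "\<epsilon> / (2 * BN)" s])
    show "f1 holomorphic_on gen_strip (\<lambda>t. a' * F t) (\<lambda>t. a' * G t)"
      unfolding f1_def by (intro holomorphic_intros holf[unfolded Y_def])
    have "norm (f1 z) \<le> B" if "z \<in> Y" for z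
    proof -
      have "B * exp (- (\<kappa> * exp (\<mu> * \<bar>Re z\<bar>))) \<le> B * 1"
        using B(1) \<kappa> by (intro mult_left_mono) auto
      then show ?thesis using f1[OF that] by linarith
    qed
    then show "bounded (f1 ` gen_strip (\<lambda>t. a' * F t) (\<lambda>t. a' * G t))"
      by (auto simp: bounded_iff Y_def)
    show "norm (f1 z) \<le> B * D * exp (- \<bar>Re z\<bar>)"
      if "z \<in> gen_strip (\<lambda>t. a' * F t) (\<lambda>t. a' * G t)" for z
    proof -
      have "B * exp (- (\<kappa> * exp (\<mu> * \<bar>Re z\<bar>))) \<le> B * (D * exp (- \<bar>Re z\<bar>))"
        using B(1) D[of "\<bar>Re z\<bar>"] by (intro mult_left_mono) auto
      then show ?thesis using f1[of z] that by (simp add: Y_def mult.assoc)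
    qed
  qed (use \<epsilon> BN(1) that in \<open>auto simp: X_def\<close>)
  obtain Bh where Bh: "Bh > 0" "\<And>z. z \<in> X \<Longrightarrow> norm (h z) \<le> Bh"
    using h(2) by (auto simp: bounded_pos)

  define g where "g = (\<lambda>z. damp \<delta> \<mu> z * h z)"
  have "g \<in> U_space (W K) (\<lambda>t. b * F t) (\<lambda>t. b * G t)"
  proof (rule U_spaceI[OF F(1) G(1)])
    show "g holomorphic_on gen_strip (\<lambda>t. F t + s) (\<lambda>t. G t + s)"
      unfolding g_def by (intro holomorphic_intros h(1)[unfolded X_def])
    show "s - 1 / 2 < s" by simp
    have le: "(b - 1) * F t \<le> (b - 1) * S" "(b - 1) * G t \<le> (b - 1) * S" for t
      using ab S by (auto intro!: mult_left_mono)
    show "b * F t < F t + (s - 1 / 2)" "b * G t < G t + (s - 1 / 2)" for t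
      using le[of t] by (simp_all add: s_def algebra_simps)
    show "0 \<le> b * F t" "0 \<le> b * G t" for t
      using ab pos[of t] by auto
    show "continuous_on UNIV (\<lambda>t. b * F t)" "continuous_on UNIV (\<lambda>t. b * G t)"
      using F(1) G(1) by (intro continuous_intros uniformly_continuous_imp_continuous; simp)+
    show "exp (W K \<bar>x\<bar>) * norm (g z) \<le> BK * Bh"
      if z: "z \<in> gen_strip (\<lambda>t. F t + s) (\<lambda>t. G t + s)" and x: "\<bar>x - Re z\<bar> \<le> 1" for x z
    proof -
      have z: "z \<in> X" using z by (simp add: X_def)
      have "exp (W K \<bar>x\<bar>) * norm (damp \<delta> \<mu> z) \<le> exp (W K \<bar>x\<bar>) * exp (- (\<kappa> * exp (\<mu> * \<bar>Re z\<bar>)))"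
        using damp[OF XH[OF z]] by (intro mult_left_mono) auto
      also have "\<dots> \<le> BK" using BK(2)[OF x] .
      finally have "(exp (W K \<bar>x\<bar>) * norm (damp \<delta> \<mu> z)) * norm (h z) \<le> BK * Bh"
        using Bh(2)[OF z] BK(1) by (intro mult_mono) auto
      then show ?thesis by (simp add: g_def norm_mult mult.assoc)
    qed
  qed
  moreover have "exp (W N \<bar>Re z\<bar>) * norm (f z - g z) \<le> \<epsilon>"
    if z: "- G (Re z) \<le> Im z" "Im z \<le> F (Re z)" for z
  proof -
    let ?E = "exp (W N \<bar>Re z\<bar>)"
    \<comment> \<open>The first term is the damping error, the second the damped error of the
      bounded approximation; each contributes \<epsilon>/2.\<close>
    have eq: "f z - g z = (f z - f z * damp (2 * \<delta>) \<mu> z) + damp \<delta> \<mu> z * (f1 z - h z)"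
      unfolding damp_double by (simp add: f1_def g_def algebra_simps)
    have "norm (f z - g z) \<le> norm (f z - f z * damp (2 * \<delta>) \<mu> z) + norm (damp \<delta> \<mu> z * (f1 z - h z))"
      by (subst eq) (rule norm_triangle_ineq)
    then have "?E * norm (f z - g z) \<le> ?E * (norm (f z - f z * damp (2 * \<delta>) \<mu> z) + norm (damp \<delta> \<mu> z * (f1 z - h z)))"
      by (intro mult_left_mono) auto
    also have "\<dots> = ?E * norm (f z - f z * damp (2 * \<delta>) \<mu> z) + (?E * norm (damp \<delta> \<mu> z)) * norm (f1 z - h z)"
      by (simp only: norm_mult distrib_left mult.assoc)
    also have "\<dots> \<le> \<epsilon> / 2 + BN * (\<epsilon> / (2 * BN))"
    proof (intro add_mono mult_mono)
      have "?E * norm (damp \<delta> \<mu> z) \<le> ?E * exp (- (\<kappa> * exp (\<mu> * \<bar>Re z\<bar>)))"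
        using damp[OF YH[OF ZY[OF z]]] by (intro mult_left_mono) auto
      also have "\<dots> \<le> BN" by (rule BN(2)) simp
      finally show "?E * norm (damp \<delta> \<mu> z) \<le> BN" .
    qed (use part1[OF ZY[OF z]] h(3)[OF z] BN(1) in auto)
    also have "\<dots> = \<epsilon>" using BN(1) by simp
    finally show ?thesis .
  qed
  ultimately show ?thesis by blast
qed

theorem theorem4p1:
  fixes F G :: "real \<Rightarrow> real" and W :: "nat \<Rightarrow> real \<Rightarrow> real"
  assumes "F \<in> strip_functions" and "G \<in> strip_functions"
    and "weight_function_system W"
    and "cond_alpha W" and "cond_N W" and "cond_epsilon0 W"
  shows "\<forall>N. \<exists>M>N. \<forall>K>M. \<forall>a b :: real. 1 < a \<and> a < b \<longrightarrow>
    (\<forall>\<epsilon>>0::real.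
      \<forall>f \<in> U_space (W M) (\<lambda>t. a * F t) (\<lambda>t. a * G t).
      \<exists>g \<in> U_space (W K) (\<lambda>t. b * F t) (\<lambda>t. b * G t).
        (SUP \<xi>\<in>closure (gen_strip F G).
           ereal (exp (W N \<bar>Re \<xi>\<bar>) * norm (f \<xi> - g \<xi>))) \<le> ereal \<epsilon>)"
proof
  fix N
  \<comment> \<open>\<open>M\<close> comes from the weights alone, before \<open>K\<close>,
    \<open>a\<close>, \<open>b\<close> and \<epsilon> are given.\<close>
  obtain M C where M: "M > N" "C \<ge> 0" "\<And>u. u > 0 \<Longrightarrow> exp (W N u - W M u) \<le> C / u"
    using weight_gap[OF assms(3-5)] by blast
  have cont: "continuous_on UNIV F" "continuous_on UNIV G"
    using assms(1,2) by (auto simp: strip_functions_def intro: uniformly_continuous_imp_continuous)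
  have "\<exists>g\<in>U_space (W K) (\<lambda>t. b * F t) (\<lambda>t. b * G t).
      (SUP \<xi>\<in>closure (gen_strip F G). ereal (exp (W N \<bar>Re \<xi>\<bar>) * norm (f \<xi> - g \<xi>))) \<le> ereal \<epsilon>"
    if hyps: "1 < a" "a < b" "0 < \<epsilon>" "f \<in> U_space (W M) (\<lambda>t. a * F t) (\<lambda>t. a * G t)" for K a b \<epsilon> f
  proof -
    obtain g where "g \<in> U_space (W K) (\<lambda>t. b * F t) (\<lambda>t. b * G t)"
      "\<And>z. - G (Re z) \<le> Im z \<Longrightarrow> Im z \<le> F (Re z) \<Longrightarrow> exp (W N \<bar>Re z\<bar>) * norm (f z - g z) \<le> \<epsilon>"
      using strip_weighted_approx[where N = N and M = M, OF assms(1,2,3,6) M(2) _ _ hyps, of K] M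
      by (auto dest: less_imp_le)
    then show ?thesis
      using closure_gen_strip_subset[OF cont] by (intro bexI[of _ g] SUP_least) auto
  qed
  then show "\<exists>M>N. \<forall>K>M. \<forall>a b :: real. 1 < a \<and> a < b \<longrightarrow>
    (\<forall>\<epsilon>>0::real.
      \<forall>f \<in> U_space (W M) (\<lambda>t. a * F t) (\<lambda>t. a * G t).
      \<exists>g \<in> U_space (W K) (\<lambda>t. b * F t) (\<lambda>t. b * G t).
        (SUP \<xi>\<in>closure (gen_strip F G).
           ereal (exp (W N \<bar>Re \<xi>\<bar>) * norm (f \<xi> - g \<xi>))) \<le> ereal \<epsilon>)"
    using M(1) by blast
qed

end
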